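(* For every $m\in\mathbb N$ there exists a constant $\mathcal C_m>0$ such that for all $\epsilon\in(0,1)$ and all $\alpha\in[0,2]$: if $u$ is the solution of $$i\partial_tu+\epsilon^\alpha\partial_x^2u=\Pi(|u|^2u)$$ with $u(0)\in H^1_+$ and $\|u(0)-\mathbf e_m\|_{H^1}=\epsilon$, then $$\sup_{t\in\mathbb R}\ \inf_{\theta\in\mathbb R}\|u(t)-e^{i\theta}\mathbf e_m\|_{H^1}\le \mathcal C_m\,\epsilon^{1-\frac\alpha2}.$$
   Context: $\mathbb N=\{0,1,2,\dots\}$, $\mathbb S^1=\mathbb R/2\pi\mathbb Z$, $\mathbf e_m(x)=e^{imx}$. $\Pi$ is the Szegő projector $\Pi(\sum_{k\in\mathbb Z}u_ke^{ikx})=\sum_{k\ge0}u_ke^{ikx}$ on $L^2(\mathbb S^1)$; $L^2_+=\Pi(L^2(\mathbb S^1))$, $H^s_+=H^s(\mathbb S^1)\cap L^2_+$, with $\|u\|_{H^s}^2=\sum_k(1+k^2)^s|u_k|^2$. For data in $H^s_+$, $s\ge\frac12$, the solution is the unique global solution $u\in C(\mathbb R,H^s_+)$. *)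

theory Defs
  imports "HOL-Analysis.Analysis"
begin

text \<open>Functions on the circle are represented by \<open>2\<pi>\<close>-periodic functions on the real line. Elements
  of \<open>L\<^sup>2\<close> are classes modulo null sets; norms and Fourier coefficients are Lebesgue integrals and
  do not depend on the representative. A periodic distribution is represented by the sequence of
  its Fourier coefficients, which is needed for \<open>H\<^sup>s\<close> with negative \<open>s\<close>.\<close>

definition L2_circle :: "(real \<Rightarrow> complex) set" where
  "L2_circle = {f. (\<forall>x. f (x + 2 * pi) = f x) \<and> f \<in> borel_measurable borel \<and>
     set_integrable lborel {0..2*pi} (\<lambda>x. (cmod (f x))\<^sup>2)}"

text \<open>The measure is normalised so that \<open>f = (\<Sum>k. fourier_coeff f k * exp (i k x))\<close>.\<close>

definition fourier_coeff :: "(real \<Rightarrow> complex) \<Rightarrow> int \<Rightarrow> complex" where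
  "fourier_coeff f k =
     (LBINT x:{0..2*pi}. f x * exp (- \<i> * of_int k * of_real x)) / of_real (2 * pi)"

definition sobolev_seq :: "real \<Rightarrow> (int \<Rightarrow> complex) set" where
  "sobolev_seq s =
     {c. (\<lambda>k. (1 + (real_of_int k)\<^sup>2) powr s * (cmod (c k))\<^sup>2) summable_on UNIV}"

definition sobolev_seq_norm :: "real \<Rightarrow> (int \<Rightarrow> complex) \<Rightarrow> real" where
  "sobolev_seq_norm s c =
     sqrt (\<Sum>\<^sub>\<infinity>k. (1 + (real_of_int k)\<^sup>2) powr s * (cmod (c k))\<^sup>2)"

definition sobolev_norm :: "real \<Rightarrow> (real \<Rightarrow> complex) \<Rightarrow> real" where
  "sobolev_norm s f = sobolev_seq_norm s (fourier_coeff f)"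

definition szego :: "(int \<Rightarrow> complex) \<Rightarrow> int \<Rightarrow> complex" where
  "szego c k = (if k \<ge> 0 then c k else 0)"

text \<open>The image of \<open>L\<^sup>2\<close> under the projector.\<close>

definition L2_plus :: "(real \<Rightarrow> complex) set" where
  "L2_plus = {f \<in> L2_circle. \<exists>g \<in> L2_circle. fourier_coeff f = szego (fourier_coeff g)}"

text \<open>Only for \<open>s \<ge> 0\<close>, where \<open>H\<^sup>s\<close> is contained in \<open>L\<^sup>2\<close>.\<close>

definition sobolev_plus :: "real \<Rightarrow> (real \<Rightarrow> complex) set" where
  "sobolev_plus s = {f \<in> L2_plus. fourier_coeff f \<in> sobolev_seq s}"

text \<open>Distributional derivative in \<open>x\<close>, on Fourier coefficients.\<close>

definition deriv_x :: "(int \<Rightarrow> complex) \<Rightarrow> int \<Rightarrow> complex" where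
  "deriv_x c k = \<i> * of_int k * c k"

definition has_sobolev_derivative ::
    "real \<Rightarrow> (real \<Rightarrow> int \<Rightarrow> complex) \<Rightarrow> (int \<Rightarrow> complex) \<Rightarrow> real \<Rightarrow> bool" where
  "has_sobolev_derivative s c c' t \<longleftrightarrow>
     (\<forall>\<tau>. c \<tau> \<in> sobolev_seq s) \<and> c' \<in> sobolev_seq s \<and>
     ((\<lambda>h. sobolev_seq_norm s (\<lambda>k. (c (t + h) k - c t k) / of_real h - c' k)) \<longlongrightarrow> 0) (at 0)"

text \<open>Global solutions \<open>u \<in> C(\<real>, H\<^sup>s\<^sub>+)\<close> of
  \<open>i \<partial>\<^sub>t u + \<epsilon>\<^sup>\<alpha> \<partial>\<^sub>x\<^sup>2 u = \<Pi>(|u|\<^sup>2 u)\<close>. The second derivative in \<open>x\<close> loses two degrees of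
  regularity, so \<open>\<partial>\<^sub>t u\<close> is taken in, and the equation holds in, \<open>H\<close> of order \<open>s - 2\<close>.\<close>

definition nls_szego_solution ::
    "real \<Rightarrow> real \<Rightarrow> real \<Rightarrow> (real \<Rightarrow> real \<Rightarrow> complex) \<Rightarrow> bool" where
  "nls_szego_solution s \<epsilon> \<alpha> u \<longleftrightarrow>
     (\<forall>t. u t \<in> sobolev_plus s) \<and>
     (\<forall>t. ((\<lambda>\<tau>. sobolev_norm s (\<lambda>x. u \<tau> x - u t x)) \<longlongrightarrow> 0) (at t)) \<and>
     (\<exists>ut. \<forall>t. has_sobolev_derivative (s - 2) (\<lambda>\<tau>. fourier_coeff (u \<tau>)) (ut t) t \<and>
        (\<forall>k. \<i> * ut t k + of_real (\<epsilon> powr \<alpha>) * deriv_x (deriv_x (fourier_coeff (u t))) k =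
             szego (fourier_coeff (\<lambda>x. of_real ((cmod (u t x))\<^sup>2) * u t x)) k))"

definition fourier_mode :: "nat \<Rightarrow> real \<Rightarrow> complex" where
  "fourier_mode m x = exp (\<i> * of_nat m * of_real x)"

end

theory Submission
  imports Defs
begin

text \<open>Write \<open>\<mu> = \<epsilon>\<^sup>\<alpha>\<close> and \<open>u\<^sub>k\<close> for the Fourier coefficients of the solution. The equation conserves the
  mass \<open>M = \<Sum>|u\<^sub>k|\<^sup>2\<close>, the momentum \<open>P = \<Sum>k |u\<^sub>k|\<^sup>2\<close> and the Hamiltonian
  \<open>E = \<mu> \<Sum>k\<^sup>2 |u\<^sub>k|\<^sup>2 + \<parallel>u\<parallel>\<^sup>4 / 2\<close>, with the norm of \<open>L\<^sup>4\<close>. Hence it conserves the combination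
  \<open>F = \<mu> \<Sum>(k - m)\<^sup>2 |u\<^sub>k|\<^sup>2 + mean ((|u|\<^sup>2 - 1)\<^sup>2) / 2\<close>, that is, \<open>E - 2 \<mu> m P + (\<mu> m\<^sup>2 - 1) M + 1/2\<close>.
  Both summands are nonnegative, vanish on the orbit of \<open>e\<^sub>m\<close>, and are of order \<open>\<epsilon>\<^sup>2\<close> initially. So
  \<open>\<Sum>(k - m)\<^sup>2 |u\<^sub>k(t)|\<^sup>2\<close> is of order \<open>\<epsilon>\<^sup>2 / \<mu>\<close> for all times, which is the square of
  \<open>\<epsilon>\<^bsup>1 - \<alpha>/2\<^esup>\<close>. This bounds all modes except \<open>m\<close> in \<open>H\<^sup>1\<close>; conservation of mass then shows
  that \<open>|u\<^sub>m(t)|\<close> is close to 1, and the phase \<open>\<theta>\<close> is the argument of \<open>u\<^sub>m(t)\<close>. These estimates are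
  \<open>energy_ge\<close>, \<open>energy_initial_le\<close>, \<open>orbital_bounds\<close> and \<open>orbital_distance_le\<close>.

  The conservation laws need care, because the solution is continuous in \<open>H\<^sup>1\<close> while its time derivative
  lies only in \<open>H\<close> of order \<open>-1\<close>, so \<open>P\<close> and \<open>E\<close> cannot be differentiated directly. Instead the functionals
  are evaluated on the truncation of the Fourier series at \<open>N\<close>. Their time derivatives then reduce to
  differences between the full and the truncated nonlinearity. Written in coefficients, these are sums over
  quadruples of modes with \<open>i + l = j + k\<close> that leave the box of size \<open>N\<close>; they tend to zero with a bound
  that depends only on the \<open>H\<^sup>1\<close> norm (\<open>truncation_error_weighted\<close>, \<open>truncation_error_cubic\<close>). Dominated
  convergence in time shows that the increments of the truncated functionals tend to zero
  (\<open>mass_increment\<close>, \<open>energy_increment\<close>), which suffices for the estimates above.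

  To express the coefficients of \<open>|u|\<^sup>2 u\<close> by those of \<open>u\<close>, the function \<open>u\<close> has to agree almost everywhere
  with the sum of its Fourier series. This rests on the uniqueness theorem \<open>fourier_uniqueness\<close>
  for integrable functions, which follows from the Stone--Weierstrass theorem on the unit circle.\<close>

section \<open>Fourier coefficients on the circle\<close>

definition circle :: "real measure" where
  "circle = restrict_space lborel {0..2 * pi}"

definition wave :: "int \<Rightarrow> real \<Rightarrow> complex" where
  "wave k x = exp (\<i> * of_int k * of_real x)"

definition mean :: "(real \<Rightarrow> complex) \<Rightarrow> complex" where
  "mean f = integral\<^sup>L circle f / of_real (2 * pi)"

lemma wave_add: "wave (j + k) x = wave j x * wave k x"
  by (simp add: wave_def algebra_simps flip: exp_add)

lemma wave_0 [simp]: "wave 0 x = 1"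
  by (simp add: wave_def)

lemma cnj_wave: "cnj (wave k x) = wave (- k) x"
  by (simp add: wave_def exp_cnj)

lemma norm_wave [simp]: "cmod (wave k x) = 1"
  by (simp add: wave_def norm_exp_i_times[of "of_int k * x", simplified] mult.assoc)

lemma fourier_mode_eq_wave: "fourier_mode m = wave (int m)"
  by (simp add: fourier_mode_def wave_def fun_eq_iff)

lemma continuous_on_wave [continuous_intros]: "continuous_on S (wave k)"
  unfolding wave_def by (intro continuous_intros)

lemma finite_measure_circle: "finite_measure circle"
  by (rule finite_measureI) (simp add: circle_def emeasure_restrict_space space_restrict_space)

lemma measure_circle: "measure circle (space circle) = 2 * pi"
  by (simp add: circle_def measure_restrict_space space_restrict_space)

lemma measurable_circle:
  fixes f :: "real \<Rightarrow> 'a::topological_space"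
  shows "f \<in> borel_measurable borel \<Longrightarrow> f \<in> borel_measurable circle"
  by (simp add: circle_def measurable_restrict_space1)

lemma wave_measurable [measurable]: "wave k \<in> borel_measurable borel"
  by (intro borel_measurable_continuous_onI continuous_intros)

lemma integrable_circle_bounded:
  fixes f :: "real \<Rightarrow> complex"
  assumes "f \<in> borel_measurable borel" "\<And>x. cmod (f x) \<le> B"
  shows "integrable circle f"
proof (rule finite_measure.integrable_const_bound[OF finite_measure_circle])
  show "f \<in> borel_measurable circle" by (rule measurable_circle[OF assms(1)])
  show "AE x in circle. cmod (f x) \<le> B" by (rule AE_I2) (rule assms(2))
qed

lemma integrable_wave [simp]: "integrable circle (wave k)"
  by (rule integrable_circle_bounded[where B = 1, OF wave_measurable]) simp

lemma integrable_mult_wave: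
  assumes "integrable circle f"
  shows "integrable circle (\<lambda>x. f x * wave k x)"
proof (rule Bochner_Integration.integrable_bound[OF assms])
  show "(\<lambda>x. f x * wave k x) \<in> borel_measurable circle"
    using borel_measurable_integrable[OF assms] measurable_circle[OF wave_measurable]
    by (rule borel_measurable_times)
qed (simp add: norm_mult)

lemma fourier_coeff_eq_mean: "fourier_coeff f k = mean (\<lambda>x. f x * wave (- k) x)"
  by (simp add: fourier_coeff_def mean_def set_lebesgue_integral_def circle_def
      integral_restrict_space wave_def)

text \<open>Orthonormality of the exponentials, from the primitive \<open>wave k / (i k)\<close> and its periodicity.\<close>

lemma mean_wave: "mean (wave k) = (if k = 0 then 1 else 0)"
proof (cases "k = 0")
  case True
  then have "wave k = (\<lambda>_. 1)" by (simp add: fun_eq_iff)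
  then show ?thesis using True by (simp add: mean_def measure_circle scaleR_conv_of_real)
next
  case False
  define F where "F x = wave k x / (\<i> * of_int k)" for x
  have der: "(F has_vector_derivative wave k x) (at x within {0..2 * pi})" for x
  proof -
    have "((\<lambda>x. wave k x) has_vector_derivative (\<i> * of_int k * wave k x)) (at x within {0..2 * pi})"
      unfolding wave_def
      by (rule has_vector_derivative_real_field[where f = "\<lambda>z. exp (\<i> * of_int k * z)"])
         (auto intro!: derivative_eq_intros)
    then have "((\<lambda>x. wave k x / (\<i> * of_int k)) has_vector_derivative
        (\<i> * of_int k * wave k x) / (\<i> * of_int k)) (at x within {0..2 * pi})"
      by (rule has_vector_derivative_divide)
    then show ?thesis using False by (simp add: F_def [abs_def])
  qed
  have "integral\<^sup>L circle (wave k) = (\<integral>x. indicator {0..2*pi} x *\<^sub>R wave k x \<partial>lborel)"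
    by (simp add: circle_def integral_restrict_space)
  also have "\<dots> = F (2 * pi) - F 0"
    by (rule integral_FTC_Icc[OF _ der]) (auto intro: continuous_intros)
  also have "wave k (2 * pi) = 1"
    using cis_multiple_2pi[of "of_int k"] by (simp add: wave_def cis_conv_exp mult_ac)
  then have "F (2 * pi) - F 0 = 0" by (simp add: F_def wave_def)
  finally show ?thesis using False by (simp add: mean_def)
qed

lemma mean_sum: "(\<And>i. i \<in> I \<Longrightarrow> integrable circle (f i)) \<Longrightarrow>
    mean (\<lambda>x. \<Sum>i\<in>I. f i x) = (\<Sum>i\<in>I. mean (f i))"
  by (simp add: mean_def sum_divide_distrib)

lemma mean_cmult: "mean (\<lambda>x. a * f x) = a * mean f"
  by (simp add: mean_def)

lemma fourier_coeff_diff: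
  assumes "integrable circle f" "integrable circle g"
  shows "fourier_coeff (\<lambda>x. f x - g x) k = fourier_coeff f k - fourier_coeff g k"
  using integrable_mult_wave[OF assms(1)] integrable_mult_wave[OF assms(2)]
  by (simp add: fourier_coeff_eq_mean mean_def left_diff_distrib diff_divide_distrib)

lemma fourier_coeff_wave: "fourier_coeff (\<lambda>x. a * wave j x) k = (if k = j then a else 0)"
proof -
  have "fourier_coeff (\<lambda>x. a * wave j x) k = mean (\<lambda>x. a * wave (j - k) x)"
    by (simp add: fourier_coeff_eq_mean mult.assoc flip: wave_add)
  then show ?thesis by (simp add: mean_cmult mean_wave)
qed

lemma L2_circle_integrable:
  assumes "f \<in> L2_circle"
  shows "integrable circle f"
proof -
  have f: "f \<in> borel_measurable borel" and sq: "integrable circle (\<lambda>x. (cmod (f x))\<^sup>2)"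
    using assms by (auto simp: L2_circle_def circle_def integrable_restrict_space set_integrable_def)
  have "integrable circle (\<lambda>x. 1 + (cmod (f x))\<^sup>2)"
    by (rule Bochner_Integration.integrable_add[OF finite_measure.integrable_const[OF finite_measure_circle] sq])
  then show ?thesis
  proof (rule Bochner_Integration.integrable_bound)
    have "cmod (f x) \<le> 1 + (cmod (f x))\<^sup>2" for x
    proof -
      have "0 \<le> (cmod (f x) - 1)\<^sup>2 + (cmod (f x))\<^sup>2 + 1" by simp
      then show ?thesis by (simp add: power2_diff)
    qed
    then show "AE x in circle. cmod (f x) \<le> norm (1 + (cmod (f x))\<^sup>2)"
      by (auto simp: abs_of_nonneg add_nonneg_nonneg)
  qed (rule measurable_circle[OF f])
qed

section \<open>Uniqueness of Fourier coefficients\<close>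

text \<open>Trigonometric polynomials are generated without reference to their degree, so that closure under
  products is two inductions and needs no bookkeeping of frequencies.\<close>

inductive trigonometric :: "(real \<Rightarrow> complex) \<Rightarrow> bool" where
  monomial: "trigonometric (\<lambda>x. a * wave k x)"
| add: "trigonometric p \<Longrightarrow> trigonometric q \<Longrightarrow> trigonometric (\<lambda>x. p x + q x)"

lemma trigonometric_mult_monomial:
  "trigonometric p \<Longrightarrow> trigonometric (\<lambda>x. (a * wave k x) * p x)"
proof (induction rule: trigonometric.induct)
  case (monomial b j)
  have "(\<lambda>x. (a * wave k x) * (b * wave j x)) = (\<lambda>x. (a * b) * wave (k + j) x)"
    by (simp add: wave_add mult_ac)
  then show ?case by (simp only: trigonometric.monomial)
next
  case (add p q)
  then show ?case by (simp only: distrib_left trigonometric.add)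
qed

lemma trigonometric_mult:
  assumes "trigonometric p" "trigonometric q"
  shows "trigonometric (\<lambda>x. p x * q x)"
  using assms(1)
proof (induction rule: trigonometric.induct)
  case (monomial b j)
  show ?case by (rule trigonometric_mult_monomial[OF assms(2)])
next
  case (add p p')
  then show ?case by (simp only: distrib_right trigonometric.add)
qed

text \<open>The coordinates of the point \<open>wave 1 x\<close> are combinations of \<open>wave 1\<close> and \<open>wave (- 1)\<close>. This makes
  the polynomials in two real variables, which the Stone--Weierstrass theorem provides on the unit
  circle, trigonometric polynomials in \<open>x\<close>.\<close>

lemma trigonometric_polynomial_on_circle:
  fixes p :: "complex \<Rightarrow> real"
  assumes "real_polynomial_function p"
  shows "trigonometric (\<lambda>x. of_real (p (wave 1 x)))"
  using assms
proof (induction rule: real_polynomial_function.induct)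
  case (linear f)
  define a where "a = (of_real (f 1) - \<i> * of_real (f \<i>)) / 2"
  define b where "b = (of_real (f 1) + \<i> * of_real (f \<i>)) / 2"
  have "complex_of_real (f z) = a * z + b * cnj z" for z
  proof -
    have "z = Re z *\<^sub>R 1 + Im z *\<^sub>R \<i>" by (simp add: complex_eq_iff)
    then have "f z = f (Re z *\<^sub>R 1 + Im z *\<^sub>R \<i>)" by simp
    also have "\<dots> = Re z * f 1 + Im z * f \<i>"
      by (simp only: linear_add[OF bounded_linear.linear[OF linear]]
          linear_scale[OF bounded_linear.linear[OF linear]] real_scaleR_def)
    finally show ?thesis
      by (simp add: a_def b_def complex_eq_iff field_simps)
  qed
  then have "(\<lambda>x. complex_of_real (f (wave 1 x))) = (\<lambda>x. a * wave 1 x + b * wave (- 1) x)"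
    by (simp add: cnj_wave)
  then show ?case by (simp only: trigonometric.intros)
next
  case (const c)
  show ?case using trigonometric.monomial[of "of_real c" 0] by simp
next
  case (add f g)
  then show ?case by (simp only: of_real_add trigonometric.add)
next
  case (mult f g)
  then show ?case by (simp only: of_real_mult trigonometric_mult)
qed

lemma integrable_circle_mult_bounded:
  fixes f h :: "real \<Rightarrow> complex"
  assumes "integrable circle f" "h \<in> borel_measurable borel" "\<And>x. cmod (h x) \<le> B"
  shows "integrable circle (\<lambda>x. f x * h x)"
proof (rule Bochner_Integration.integrable_bound)
  show "integrable circle (\<lambda>x. of_real B * f x)" using assms(1) by simp
  show "(\<lambda>x. f x * h x) \<in> borel_measurable circle"
    using borel_measurable_integrable[OF assms(1)] measurable_circle[OF assms(2)]
    by (rule borel_measurable_times)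
  have "cmod (f x) * cmod (h x) \<le> \<bar>B\<bar> * cmod (f x)" for x
    using mult_right_mono[of "cmod (h x)" "\<bar>B\<bar>" "cmod (f x)"] assms(3)[of x] by (simp add: mult.commute)
  then show "AE x in circle. cmod (f x * h x) \<le> cmod (of_real B * f x)"
    by (simp add: norm_mult)
qed

lemma mean_mult_trigonometric_eq_0:
  assumes "integrable circle g" "\<And>k. fourier_coeff g k = 0" "trigonometric p"
  shows "integrable circle (\<lambda>x. g x * p x) \<and> mean (\<lambda>x. g x * p x) = 0"
  using assms(3)
proof (induction rule: trigonometric.induct)
  case (monomial a k)
  have "mean (\<lambda>x. g x * (a * wave k x)) = a * mean (\<lambda>x. g x * wave k x)"
    by (simp add: mult_ac flip: mean_cmult)
  also have "mean (\<lambda>x. g x * wave k x) = 0"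
    using assms(2)[of "- k"] by (simp add: fourier_coeff_eq_mean)
  finally show ?case
    using integrable_mult_right[OF integrable_mult_wave[OF assms(1), of k], of a] by (simp add: mult_ac)
next
  case (add p q)
  then show ?case by (simp add: distrib_left mean_def)
qed

text \<open>Working with functions of \<open>wave 1 x\<close> replaces the periodicity condition: every continuous function on
  the plane is an admissible test function, and is uniformly close on the circle to a trigonometric
  polynomial, against which \<open>g\<close> integrates to zero.\<close>

lemma mean_mult_continuous_eq_0:
  fixes h :: "complex \<Rightarrow> real"
  assumes g: "integrable circle g" "\<And>k. fourier_coeff g k = 0" and h: "continuous_on UNIV h"
    and B: "\<And>z. \<bar>h z\<bar> \<le> B"
  shows "mean (\<lambda>x. g x * of_real (h (wave 1 x))) = 0"
proof -
  define G where "G = (\<integral>x. cmod (g x) \<partial>circle)"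
  have hm: "(\<lambda>x. complex_of_real (h (wave 1 x))) \<in> borel_measurable borel"
    using borel_measurable_continuous_onI[OF h] by measurable
  have ih: "integrable circle (\<lambda>x. g x * of_real (h (wave 1 x)))"
    by (rule integrable_circle_mult_bounded[OF g(1) hm, where B = B]) (simp only: norm_of_real B)
  have small: "cmod (integral\<^sup>L circle (\<lambda>x. g x * of_real (h (wave 1 x)))) \<le> e * G" if "e > 0" for e
  proof -
    obtain p where p: "real_polynomial_function p" "\<And>z. z \<in> sphere 0 1 \<Longrightarrow> \<bar>h z - p z\<bar> < e"
      using Stone_Weierstrass_real_polynomial_function[of "sphere (0::complex) 1" h e]
        continuous_on_subset[OF h] \<open>e > 0\<close> by auto
    have z: "integrable circle (\<lambda>x. g x * of_real (p (wave 1 x)))"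
      "integral\<^sup>L circle (\<lambda>x. g x * of_real (p (wave 1 x))) = 0"
      using mean_mult_trigonometric_eq_0[OF g trigonometric_polynomial_on_circle[OF p(1)]]
      by (auto simp: mean_def)
    have "integral\<^sup>L circle (\<lambda>x. g x * of_real (h (wave 1 x)))
        = integral\<^sup>L circle (\<lambda>x. g x * of_real (h (wave 1 x)) - g x * of_real (p (wave 1 x)))"
      using ih z by simp
    also have "cmod \<dots> \<le> (\<integral>x. cmod (g x * of_real (h (wave 1 x)) - g x * of_real (p (wave 1 x))) \<partial>circle)"
      by (rule integral_norm_bound)
    also have "\<dots> \<le> (\<integral>x. e * cmod (g x) \<partial>circle)"
    proof (rule integral_mono)
      show "integrable circle (\<lambda>x. cmod (g x * of_real (h (wave 1 x)) - g x * of_real (p (wave 1 x))))"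
        using ih z(1) by simp
      show "integrable circle (\<lambda>x. e * cmod (g x))" using g(1) by simp
      fix x
      have "cmod (g x * of_real (h (wave 1 x)) - g x * of_real (p (wave 1 x)))
          = cmod (g x * of_real (h (wave 1 x) - p (wave 1 x)))"
        by (simp add: algebra_simps)
      also have "\<dots> = cmod (g x) * \<bar>h (wave 1 x) - p (wave 1 x)\<bar>"
        by (simp only: norm_mult norm_of_real)
      also have "\<dots> \<le> cmod (g x) * e"
        using p(2)[of "wave 1 x"] by (intro mult_left_mono) auto
      finally show "cmod (g x * of_real (h (wave 1 x)) - g x * of_real (p (wave 1 x))) \<le> e * cmod (g x)"
        by (simp add: mult.commute)
    qed
    also have "\<dots> = e * G" by (simp add: G_def)
    finally show ?thesis .
  qed
  have "((\<lambda>e. e * G) \<longlongrightarrow> 0 * G) (at_right 0)" by (intro tendsto_intros)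
  moreover have "\<forall>\<^sub>F e in at_right 0. cmod (integral\<^sup>L circle (\<lambda>x. g x * of_real (h (wave 1 x)))) \<le> e * G"
    using small by (auto simp: eventually_at_right_field intro: exI[of _ 1])
  ultimately have "cmod (integral\<^sup>L circle (\<lambda>x. g x * of_real (h (wave 1 x)))) \<le> 0 * G"
    by (intro tendsto_le[OF _ _ tendsto_const]) auto
  then show ?thesis by (simp add: mean_def)
qed

lemma wave_1_inj:
  assumes "wave 1 y = wave 1 y'" "\<bar>y - y'\<bar> < 2 * pi"
  shows "y = y'"
proof -
  obtain n :: int where "\<i> * of_real y = \<i> * of_real y' + (of_int (2 * n) * of_real pi) * \<i>"
    using assms(1) by (auto simp: wave_def exp_eq)
  then have "\<i> * complex_of_real y = \<i> * complex_of_real (y' + 2 * of_int n * pi)"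
    by (simp add: algebra_simps)
  from arg_cong[OF this, of Im] have n: "y = y' + 2 * of_int n * pi" by simp
  then have "\<bar>real_of_int n\<bar> * (2 * pi) < 1 * (2 * pi)"
    using assms(2) by (simp add: abs_mult)
  then have "\<bar>real_of_int n\<bar> < 1" by (rule mult_right_less_imp_less) simp
  then have "n = 0" by linarith
  with n show ?thesis by simp
qed

text \<open>Half-lines are the generators of the Borel sets for which equality of measures is easiest to use.
  The indicator of \<open>{a<..}\<close> is approximated by truncated multiples of the distance to the complementary
  arc \<open>K\<close>. These converge off the point \<open>2 * pi\<close>, which lies over the point \<open>1\<close> of \<open>K\<close>.\<close>

lemma integral_upper_interval_eq_0:
  assumes g: "integrable circle g" "\<And>k. fourier_coeff g k = 0"
  shows "(\<integral>x. indicator {a<..} x *\<^sub>R g x \<partial>circle) = 0"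
proof -
  have sp: "space circle = {0..2 * pi}" by (simp add: circle_def space_restrict_space)
  consider "a < 0" | "a \<ge> 2 * pi" | "0 \<le> a" "a < 2 * pi" by linarith
  then show ?thesis
  proof cases
    case 1
    have "(\<integral>x. indicator {a<..} x *\<^sub>R g x \<partial>circle) = integral\<^sup>L circle g"
      using 1 by (intro Bochner_Integration.integral_cong) (auto simp: sp)
    then show ?thesis using g(2)[of 0] by (simp add: fourier_coeff_eq_mean mean_def)
  next
    case 2
    have "(\<integral>x. indicator {a<..} x *\<^sub>R g x \<partial>circle) = (\<integral>x. 0 \<partial>circle)"
      using 2 by (intro Bochner_Integration.integral_cong) (auto simp: sp)
    then show ?thesis by simp
  next
    case 3
    define K where "K = wave 1 ` {0..a}"
    have K: "closed K" "K \<noteq> {}"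
      using 3 by (auto simp: K_def intro!: compact_imp_closed compact_continuous_image continuous_intros)
    define h where "h n z = min 1 (real n * infdist z K)" for n z
    have hb: "\<bar>h n z\<bar> \<le> 1" for n z by (simp add: h_def infdist_nonneg)
    have hc: "continuous_on UNIV (h n)" for n
      unfolding h_def by (intro continuous_intros)
    have "(\<lambda>n. integral\<^sup>L circle (\<lambda>x. g x * of_real (h n (wave 1 x)))) \<longlonglongrightarrow>
        (\<integral>x. indicator {a<..} x *\<^sub>R g x \<partial>circle)"
    proof (rule integral_dominated_convergence[where w = "\<lambda>x. cmod (g x)"])
      have ind: "(indicator {a<..} :: real \<Rightarrow> real) \<in> borel_measurable circle"
        by (rule measurable_circle) measurable
      show "(\<lambda>x. indicator {a<..} x *\<^sub>R g x) \<in> borel_measurable circle"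
        by (intro borel_measurable_scaleR ind borel_measurable_integrable[OF g(1)])
      show "integrable circle (\<lambda>x. cmod (g x))" using g(1) by simp
      have hm: "(\<lambda>x. complex_of_real (h n (wave 1 x))) \<in> borel_measurable borel" for n
        using borel_measurable_continuous_onI[OF hc] by measurable
      show "(\<lambda>x. g x * of_real (h n (wave 1 x))) \<in> borel_measurable circle" for n
        by (intro borel_measurable_times borel_measurable_integrable[OF g(1)] measurable_circle hm)
      show "AE x in circle. cmod (g x * of_real (h n (wave 1 x))) \<le> cmod (g x)" for n
        by (intro AE_I2) (simp add: norm_mult mult_left_le hb)
      have "AE x in circle. x \<noteq> 2 * pi"
        unfolding circle_def using AE_lborel_singleton[of "2 * pi"]
        by (subst AE_restrict_space_iff) (auto elim: AE_mp)
      then show "AE x in circle. (\<lambda>n. g x * of_real (h n (wave 1 x))) \<longlonglongrightarrow> indicator {a<..} x *\<^sub>R g x"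
      proof (rule AE_mp, intro AE_I2 impI)
        fix x assume x: "x \<in> space circle" "x \<noteq> 2 * pi"
        have "(\<lambda>n. h n (wave 1 x)) \<longlonglongrightarrow> indicator {a<..} x"
        proof (cases "x \<le> a")
          case True
          then have "wave 1 x \<in> K" using x by (auto simp: K_def sp)
          then show ?thesis using True by (simp add: h_def)
        next
          case False
          have "wave 1 x \<notin> K"
          proof
            assume "wave 1 x \<in> K"
            then obtain y where y: "0 \<le> y" "y \<le> a" "wave 1 x = wave 1 y" by (auto simp: K_def)
            then have "x = y" using x False by (intro wave_1_inj) (auto simp: sp)
            with y False show False by simp
          qed
          then have pos: "infdist (wave 1 x) K > 0"
            using K infdist_pos_not_in_closed[of K "wave 1 x"] infdist_nonneg[of "wave 1 x" K] by auto
          obtain n0 where n0: "1 / infdist (wave 1 x) K < real n0" using reals_Archimedean2 by blast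
          then have "h n (wave 1 x) = 1" if "n \<ge> n0" for n
          proof -
            have "1 / infdist (wave 1 x) K < real n" using n0 that by linarith
            then show ?thesis using pos by (simp add: h_def field_simps)
          qed
          then have "\<forall>\<^sub>F n in sequentially. h n (wave 1 x) = 1"
            using eventually_sequentially by blast
          then show ?thesis using False by (simp add: tendsto_eventually)
        qed
        then have "(\<lambda>n. g x * of_real (h n (wave 1 x))) \<longlonglongrightarrow> g x * of_real (indicator {a<..} x)"
          by (intro tendsto_intros)
        then show "(\<lambda>n. g x * of_real (h n (wave 1 x))) \<longlonglongrightarrow> indicator {a<..} x *\<^sub>R g x"
          by (simp add: scaleR_conv_of_real mult.commute)
      qed
    qed
    moreover have "integral\<^sup>L circle (\<lambda>x. g x * of_real (h n (wave 1 x))) = 0" for n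
      using mean_mult_continuous_eq_0[OF g hc hb] by (simp add: mean_def)
    ultimately show ?thesis by (simp add: LIMSEQ_const_iff)
  qed
qed

text \<open>The positive and the negative part of \<open>g\<close> are densities of two finite measures that agree on all
  half-lines, hence everywhere, so the two densities coincide.\<close>

lemma AE_eq_0_if_upper_integrals_eq_0:
  fixes g :: "real \<Rightarrow> real"
  assumes g: "integrable lborel g" and z: "\<And>a. (\<integral>x. indicator {a<..} x * g x \<partial>lborel) = 0"
  shows "AE x in lborel. g x = 0"
proof -
  let ?p = "\<lambda>x. max 0 (g x)" and ?q = "\<lambda>x. max 0 (- g x)"
  have gm [measurable]: "g \<in> borel_measurable borel" using borel_measurable_integrable[OF g] by simp
  have int: "integrable lborel ?p" "integrable lborel ?q" using g by auto
  have em: "emeasure (density lborel (\<lambda>x. ennreal (f x))) {a<..} = ennreal (\<integral>x. indicator {a<..} x * f x \<partial>lborel)"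
    if "integrable lborel f" "\<And>x. f x \<ge> 0" for a and f :: "real \<Rightarrow> real"
  proof -
    have [measurable]: "f \<in> borel_measurable borel" using borel_measurable_integrable[OF that(1)] by simp
    have "emeasure (density lborel (\<lambda>x. ennreal (f x))) {a<..} = (\<integral>\<^sup>+x. ennreal (f x) * indicator {a<..} x \<partial>lborel)"
      by (subst emeasure_density) auto
    also have "\<dots> = (\<integral>\<^sup>+x. ennreal (indicator {a<..} x * f x) \<partial>lborel)"
      by (intro nn_integral_cong) (simp split: split_indicator)
    also have "\<dots> = ennreal (\<integral>x. indicator {a<..} x * f x \<partial>lborel)"
      using that integrable_mult_indicator[of "{a<..}" lborel f]
      by (intro nn_integral_eq_integral) auto
    finally show ?thesis .
  qed
  have eq: "(\<integral>x. indicator {a<..} x * ?p x \<partial>lborel) = (\<integral>x. indicator {a<..} x * ?q x \<partial>lborel)" for a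
  proof -
    have "(\<integral>x. indicator {a<..} x * ?p x \<partial>lborel) - (\<integral>x. indicator {a<..} x * ?q x \<partial>lborel)
       = (\<integral>x. indicator {a<..} x * ?p x - indicator {a<..} x * ?q x \<partial>lborel)"
      using int integrable_mult_indicator[of "{a<..}" lborel ?p] integrable_mult_indicator[of "{a<..}" lborel ?q]
      by (intro Bochner_Integration.integral_diff[symmetric]) auto
    also have "\<dots> = (\<integral>x. indicator {a<..} x * g x \<partial>lborel)"
      by (intro Bochner_Integration.integral_cong) (auto simp: max_def split: split_indicator)
    finally show ?thesis using z by simp
  qed
  have "density lborel (\<lambda>x. ennreal (?p x)) = density lborel (\<lambda>x. ennreal (?q x))"
    by (rule measure_eqI_lessThan) (simp_all add: em int eq)
  then have "AE x in lborel. ennreal (?p x) = ennreal (?q x)"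
    by (intro sigma_finite_measure.density_unique[OF sigma_finite_lborel]) auto
  then show ?thesis by (rule AE_mp) (auto simp: max_def split: if_splits intro!: AE_I2)
qed

lemma fourier_uniqueness:
  assumes g: "integrable circle g" "\<And>k. fourier_coeff g k = 0"
  shows "AE x in circle. g x = 0"
proof -
  have int: "integrable lborel (\<lambda>x. indicator {0..2 * pi} x *\<^sub>R g x)"
    using g(1) by (simp add: circle_def integrable_restrict_space)
  have z: "(\<integral>x. indicator {a<..} x *\<^sub>R (indicator {0..2 * pi} x *\<^sub>R g x) \<partial>lborel) = 0" for a
    using integral_upper_interval_eq_0[OF g, of a]
    by (simp add: circle_def integral_restrict_space) (simp add: mult.commute)
  have zi: "integrable lborel (\<lambda>x. indicator {a<..} x *\<^sub>R (indicator {0..2 * pi} x *\<^sub>R g x))" for a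
    by (rule integrable_mult_indicator[OF _ int]) auto
  have "AE x in lborel. L (indicator {0..2 * pi} x *\<^sub>R g x) = 0"
    if L: "bounded_linear L" for L :: "complex \<Rightarrow> real"
  proof (rule AE_eq_0_if_upper_integrals_eq_0)
    show "integrable lborel (\<lambda>x. L (indicator {0..2 * pi} x *\<^sub>R g x))"
      by (rule integrable_bounded_linear[OF L int])
    fix a
    have "(\<integral>x. indicator {a<..} x * L (indicator {0..2 * pi} x *\<^sub>R g x) \<partial>lborel)
        = (\<integral>x. L (indicator {a<..} x *\<^sub>R (indicator {0..2 * pi} x *\<^sub>R g x)) \<partial>lborel)"
      by (simp only: linear_scale[OF bounded_linear.linear[OF L]] real_scaleR_def)
    also have "\<dots> = L 0"
      using integral_bounded_linear[OF L zi] z by (simp only:)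
    finally show "(\<integral>x. indicator {a<..} x * L (indicator {0..2 * pi} x *\<^sub>R g x) \<partial>lborel) = 0"
      using linear_0[OF bounded_linear.linear[OF L]] by simp
  qed
  from this[OF bounded_linear_Re] this[OF bounded_linear_Im]
  have "AE x in lborel. x \<in> {0..2 * pi} \<longrightarrow> g x = 0"
    by eventually_elim (auto simp: complex_eq_iff)
  then show ?thesis unfolding circle_def by (subst AE_restrict_space_iff) auto
qed

section \<open>Fourier series and the cubic nonlinearity\<close>

definition partial_sum :: "(nat \<Rightarrow> complex) \<Rightarrow> nat \<Rightarrow> real \<Rightarrow> complex" where
  "partial_sum a N x = (\<Sum>k\<le>N. a k * wave (int k) x)"

text \<open>The \<open>k\<close>-th Fourier coefficient of \<open>|v|\<^sup>2 v\<close>, where \<open>v\<close> is the truncation of the series at \<open>N\<close>.\<close>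

definition cubic :: "(nat \<Rightarrow> complex) \<Rightarrow> nat \<Rightarrow> nat \<Rightarrow> complex" where
  "cubic a N k = (\<Sum>(i, l, j)\<in>{..N} \<times> {..N} \<times> {..N}.
     if i + l = j + k then a i * a l * cnj (a j) else 0)"

lemma norm_partial_sum_le: "cmod (partial_sum a N x) \<le> (\<Sum>k\<le>N. cmod (a k))"
  unfolding partial_sum_def by (rule order_trans[OF norm_sum]) (simp add: norm_mult)

lemma partial_sum_measurable [measurable]: "partial_sum a N \<in> borel_measurable borel"
  unfolding partial_sum_def by measurable

lemma integrable_partial_sum: "integrable circle (partial_sum a N)"
  by (rule integrable_circle_bounded[OF partial_sum_measurable norm_partial_sum_le])

lemma fourier_coeff_partial_sum:
  "fourier_coeff (partial_sum a N) k = (if 0 \<le> k \<and> k \<le> int N then a (nat k) else 0)"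
proof -
  have "fourier_coeff (partial_sum a N) k = (\<Sum>j\<le>N. mean (\<lambda>x. a j * wave (int j) x * wave (- k) x))"
    unfolding fourier_coeff_eq_mean partial_sum_def sum_distrib_right
    by (rule mean_sum, rule integrable_mult_wave) simp
  also have "\<dots> = (\<Sum>j\<le>N. if k = int j then a j else 0)"
    by (simp add: fourier_coeff_wave flip: fourier_coeff_eq_mean)
  also have "\<dots> = (if 0 \<le> k \<and> k \<le> int N then a (nat k) else 0)"
  proof (cases "0 \<le> k")
    case True
    then have "(\<Sum>j\<le>N. if k = int j then a j else 0) = (\<Sum>j\<le>N. if j = nat k then a j else 0)"
      by (intro sum.cong) auto
    then show ?thesis using True by (auto simp: nat_le_iff)
  next
    case False
    then show ?thesis by (intro trans[OF sum.neutral]) auto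
  qed
  finally show ?thesis .
qed

lemma fourier_coeff_dominated_limit:
  assumes m: "\<And>N. f N \<in> borel_measurable borel" "g \<in> borel_measurable circle"
    and B: "\<And>N x. cmod (f N x) \<le> B" and lim: "AE x in circle. (\<lambda>N. f N x) \<longlonglongrightarrow> g x"
  shows "(\<lambda>N. fourier_coeff (f N) k) \<longlonglongrightarrow> fourier_coeff g k"
  unfolding fourier_coeff_eq_mean mean_def
proof (intro tendsto_divide tendsto_const)
  show "(\<lambda>N. integral\<^sup>L circle (\<lambda>x. f N x * wave (- k) x)) \<longlonglongrightarrow> integral\<^sup>L circle (\<lambda>x. g x * wave (- k) x)"
  proof (rule integral_dominated_convergence[where w = "\<lambda>_. B"])
    show "integrable circle (\<lambda>_. B)" by (rule finite_measure.integrable_const[OF finite_measure_circle])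
    show "AE x in circle. (\<lambda>N. f N x * wave (- k) x) \<longlonglongrightarrow> g x * wave (- k) x"
      using lim by eventually_elim (intro tendsto_intros)
    show "(\<lambda>x. g x * wave (- k) x) \<in> borel_measurable circle"
      by (intro borel_measurable_times m measurable_circle[OF wave_measurable])
    show "(\<lambda>x. f N x * wave (- k) x) \<in> borel_measurable circle" for N
      by (intro borel_measurable_times measurable_circle[OF wave_measurable] measurable_circle[OF m(1)])
    show "AE x in circle. cmod (f N x * wave (- k) x) \<le> B" for N
      by (intro AE_I2) (simp only: norm_mult norm_wave mult_1_right B)
  qed
qed simp

text \<open>The absolutely convergent Fourier series has a bounded sum with the same coefficients as \<open>u\<close>, and
  uniqueness identifies the two. This is what turns statements about the values of \<open>u\<close>, such as the
  definition of \<open>|u|\<^sup>2 u\<close>, into statements about coefficients.\<close>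

lemma fourier_series_AE:
  assumes u: "integrable circle u" "\<And>k. k < 0 \<Longrightarrow> fourier_coeff u k = 0"
    and a: "\<And>k. a k = fourier_coeff u (int k)" and S: "\<And>N. (\<Sum>k\<le>N. cmod (a k)) \<le> S"
  shows "AE x in circle. (\<lambda>N. partial_sum a N x) \<longlonglongrightarrow> u x"
proof -
  define U where "U x = (\<Sum>k. a k * wave (int k) x)" for x
  have "summable (\<lambda>k. cmod (a k))"
    using S by (intro bounded_imp_summable[where B = S]) auto
  then have sm: "summable (\<lambda>k. a k * wave (int k) x)" for x
    by (intro summable_norm_cancel[of "\<lambda>k. a k * wave (int k) x"]) (simp add: norm_mult)
  have lim: "(\<lambda>N. partial_sum a N x) \<longlonglongrightarrow> U x" for x
    unfolding partial_sum_def U_def by (rule summable_LIMSEQ'[OF sm])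
  have Pb: "cmod (partial_sum a N x) \<le> S" for N x
    by (rule order_trans[OF norm_partial_sum_le S])
  have Um: "U \<in> borel_measurable borel"
    by (rule borel_measurable_LIMSEQ_metric[OF partial_sum_measurable]) (rule lim)
  have Ub: "cmod (U x) \<le> S" for x
    by (rule LIMSEQ_le_const2[OF tendsto_norm[OF lim]]) (use Pb in blast)
  have Ui: "integrable circle U" by (rule integrable_circle_bounded[OF Um Ub])
  have "fourier_coeff U k = fourier_coeff u k" for k
  proof (rule LIMSEQ_unique)
    show "(\<lambda>N. fourier_coeff (partial_sum a N) k) \<longlonglongrightarrow> fourier_coeff U k"
      by (rule fourier_coeff_dominated_limit[where B = S])
         (auto intro: Pb lim measurable_circle[OF Um])
    have "fourier_coeff (partial_sum a N) k = fourier_coeff u k" if "N \<ge> nat k" for N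
      using that u(2)[of k] by (auto simp: fourier_coeff_partial_sum a)
    then show "(\<lambda>N. fourier_coeff (partial_sum a N) k) \<longlonglongrightarrow> fourier_coeff u k"
      by (intro tendsto_eventually) (auto simp: eventually_sequentially)
  qed
  then have "AE x in circle. u x - U x = 0"
    using u(1) Ui by (intro fourier_uniqueness) (auto simp: fourier_coeff_diff)
  then show ?thesis by eventually_elim (use lim in simp)
qed

lemma fourier_coeff_cubic_partial_sum:
  "fourier_coeff (\<lambda>x. of_real ((cmod (partial_sum a N x))\<^sup>2) * partial_sum a N x) (int k) = cubic a N k"
proof -
  let ?I = "{..N} \<times> {..N} \<times> {..N}"
  have expand: "of_real ((cmod (partial_sum a N x))\<^sup>2) * partial_sum a N x * wave (- int k) x
      = (\<Sum>(i, l, j)\<in>?I. a i * a l * cnj (a j) * wave (int i + int l - int j - int k) x)" for x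
  proof -
    have "of_real ((cmod (partial_sum a N x))\<^sup>2) * partial_sum a N x * wave (- int k) x
       = partial_sum a N x * (partial_sum a N x * cnj (partial_sum a N x)) * wave (- int k) x"
      by (simp add: complex_norm_square[symmetric] mult_ac)
    also have "\<dots> = (\<Sum>i\<le>N. \<Sum>l\<le>N. \<Sum>j\<le>N. a i * a l * cnj (a j) * wave (int i + int l - int j - int k) x)"
    proof -
      have "(\<Sum>i\<le>N. \<Sum>l\<le>N. \<Sum>j\<le>N. a i * a l * cnj (a j) * wave (int i + int l - int j - int k) x)
        = (\<Sum>i\<le>N. \<Sum>l\<le>N. \<Sum>j\<le>N. (a i * wave (int i) x) *
            ((a l * wave (int l) x) * cnj (a j * wave (int j) x)) * wave (- int k) x)"
        by (intro sum.cong refl)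
           (simp add: wave_add cnj_wave diff_conv_add_uminus mult_ac del: add_uminus_conv_diff)
      also have "\<dots> = partial_sum a N x * (partial_sum a N x * cnj (partial_sum a N x)) * wave (- int k) x"
        by (simp only: partial_sum_def cnj_sum sum_distrib_right[symmetric] sum_distrib_left[symmetric])
      finally show ?thesis by simp
    qed
    finally show ?thesis by (simp add: sum.cartesian_product)
  qed
  have "fourier_coeff (\<lambda>x. of_real ((cmod (partial_sum a N x))\<^sup>2) * partial_sum a N x) (int k)
     = (\<Sum>p\<in>?I. mean (\<lambda>x. case p of (i, l, j) \<Rightarrow> a i * a l * cnj (a j) * wave (int i + int l - int j - int k) x))"
    unfolding fourier_coeff_eq_mean expand
    by (rule mean_sum) (auto split: prod.split)
  also have "\<dots> = cubic a N k"
    unfolding cubic_def by (intro sum.cong refl) (auto simp: mean_cmult mean_wave split: prod.split)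
  finally show ?thesis .
qed

lemma cubic_tendsto_fourier_coeff:
  assumes u: "integrable circle u" "\<And>k. k < 0 \<Longrightarrow> fourier_coeff u k = 0"
    and a: "\<And>k. a k = fourier_coeff u (int k)" and S: "\<And>N. (\<Sum>k\<le>N. cmod (a k)) \<le> S"
  shows "(\<lambda>N. cubic a N k) \<longlonglongrightarrow> fourier_coeff (\<lambda>x. of_real ((cmod (u x))\<^sup>2) * u x) (int k)"
  unfolding fourier_coeff_cubic_partial_sum[symmetric]
proof (rule fourier_coeff_dominated_limit[where B = "S ^ 3"])
  have m: "u \<in> borel_measurable circle" using u(1) by simp
  then show "(\<lambda>x. of_real ((cmod (u x))\<^sup>2) * u x) \<in> borel_measurable circle" by measurable
  show "(\<lambda>x. of_real ((cmod (partial_sum a N x))\<^sup>2) * partial_sum a N x) \<in> borel_measurable borel" for N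
    by measurable
  show "AE x in circle. (\<lambda>N. of_real ((cmod (partial_sum a N x))\<^sup>2) * partial_sum a N x)
      \<longlonglongrightarrow> of_real ((cmod (u x))\<^sup>2) * u x"
    using fourier_series_AE[OF u(1) u(2) a S, simplified] by eventually_elim (intro tendsto_intros)
  fix N x
  have "cmod (of_real ((cmod (partial_sum a N x))\<^sup>2) * partial_sum a N x) = cmod (partial_sum a N x) ^ 3"
    by (simp add: norm_mult power2_eq_square power3_eq_cube)
  also have "\<dots> \<le> S ^ 3"
    by (intro power_mono order_trans[OF norm_partial_sum_le S]) simp
  finally show "cmod (of_real ((cmod (partial_sum a N x))\<^sup>2) * partial_sum a N x) \<le> S ^ 3" .
qed

text \<open>Expanding the square gives the mean of \<open>|v|\<^sup>4\<close>, twice that of \<open>|v|\<^sup>2\<close>, and 1; pairing with \<open>cnj v\<close>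
  turns the first two into sums over coefficients. The left side is visibly nonnegative and visibly
  small when \<open>v\<close> is uniformly close to a single exponential.\<close>

lemma mean_norm_square_defect:
  "mean (\<lambda>x. of_real (((cmod (partial_sum a N x))\<^sup>2 - 1)\<^sup>2))
     = (\<Sum>k\<le>N. cnj (a k) * cubic a N k) - 2 * of_real (\<Sum>k\<le>N. (cmod (a k))\<^sup>2) + 1"
proof -
  let ?P = "partial_sum a N"
  let ?f = "\<lambda>x. of_real ((cmod (?P x))\<^sup>2) * ?P x"
  have pair: "mean (\<lambda>x. f x * cnj (?P x)) = (\<Sum>k\<le>N. cnj (a k) * fourier_coeff f (int k)) \<and>
      integrable circle (\<lambda>x. f x * cnj (?P x))"
    if f: "integrable circle f" for f
  proof
    have e: "f x * cnj (?P x) = (\<Sum>k\<le>N. cnj (a k) * (f x * wave (- int k) x))" for x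
      by (simp add: partial_sum_def cnj_sum sum_distrib_left cnj_wave mult_ac)
    show "mean (\<lambda>x. f x * cnj (?P x)) = (\<Sum>k\<le>N. cnj (a k) * fourier_coeff f (int k))"
      unfolding e fourier_coeff_eq_mean mean_cmult[symmetric]
      by (rule mean_sum) (auto intro!: integrable_mult_wave f)
    show "integrable circle (\<lambda>x. f x * cnj (?P x))"
      unfolding e by (intro Bochner_Integration.integrable_sum integrable_mult_right integrable_mult_wave f)
  qed
  have fi: "integrable circle ?f"
  proof (rule integrable_circle_bounded[where B = "(\<Sum>k\<le>N. cmod (a k)) ^ 3"])
    show "cmod (?f x) \<le> (\<Sum>k\<le>N. cmod (a k)) ^ 3" for x
      using power_mono[OF norm_partial_sum_le[of a N x] norm_ge_zero, of 3]
      by (simp add: norm_mult power2_eq_square power3_eq_cube)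
  qed measurable
  have e: "complex_of_real (((cmod (?P x))\<^sup>2 - 1)\<^sup>2) = ?f x * cnj (?P x) - 2 * (?P x * cnj (?P x)) + wave 0 x" for x
    by (simp add: power2_eq_square algebra_simps flip: complex_norm_square[unfolded power2_eq_square])
  have "mean (\<lambda>x. of_real (((cmod (?P x))\<^sup>2 - 1)\<^sup>2))
     = mean (\<lambda>x. ?f x * cnj (?P x)) - 2 * mean (\<lambda>x. ?P x * cnj (?P x)) + mean (wave 0)"
  proof -
    have int: "integrable circle (\<lambda>x. ?f x * cnj (?P x))" "integrable circle (\<lambda>x. 2 * (?P x * cnj (?P x)))"
      using pair[OF fi] pair[OF integrable_partial_sum] by auto
    show ?thesis
      unfolding e mean_cmult[symmetric, of 2] unfolding mean_def
      by (simp only: Bochner_Integration.integral_add[OF Bochner_Integration.integrable_diff[OF int] integrable_wave]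
          Bochner_Integration.integral_diff[OF int] add_divide_distrib diff_divide_distrib)
  qed
  also have "\<dots> = (\<Sum>k\<le>N. cnj (a k) * cubic a N k) - 2 * of_real (\<Sum>k\<le>N. (cmod (a k))\<^sup>2) + 1"
  proof -
    have "mean (\<lambda>x. ?P x * cnj (?P x)) = (\<Sum>k\<le>N. cnj (a k) * a k)"
      using conjunct1[OF pair[OF integrable_partial_sum, of a N]] by (simp add: fourier_coeff_partial_sum)
    also have "\<dots> = of_real (\<Sum>k\<le>N. (cmod (a k))\<^sup>2)"
      unfolding of_real_sum by (intro sum.cong refl) (simp only: complex_norm_square mult.commute)
    finally show ?thesis
      unfolding conjunct1[OF pair[OF fi]] fourier_coeff_cubic_partial_sum by (simp add: mean_wave)
  qed
  finally show ?thesis .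
qed

section \<open>Resonant quadruples\<close>

text \<open>The quartic interaction \<open>mean (|v|\<^sup>4)\<close> is a sum over quadruples with \<open>i + l = j + k\<close>. The set of
  quadruples is invariant under exchanging \<open>i\<close> and \<open>l\<close>, exchanging \<open>j\<close> and \<open>k\<close>, and exchanging the two
  pairs; the last exchange conjugates the summand. Conservation of mass and momentum is exactly
  this symmetry.\<close>

definition resonant :: "nat \<Rightarrow> (nat \<times> nat \<times> nat \<times> nat) set" where
  "resonant N = {(i, l, j, k). i \<le> N \<and> l \<le> N \<and> j \<le> N \<and> k \<le> N \<and> i + l = j + k}"

lemma finite_resonant [simp]: "finite (resonant N)"
  by (rule finite_subset[of _ "{..N} \<times> {..N} \<times> {..N} \<times> {..N}"]) (auto simp: resonant_def)

lemma resonant_mono: "N \<le> M \<Longrightarrow> resonant N \<subseteq> resonant M"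
  by (auto simp: resonant_def)

lemma sum_mult_cubic:
  assumes "N \<le> M"
  shows "(\<Sum>k\<le>N. h k * cubic a M k)
    = (\<Sum>(i, l, j, k) | (i, l, j, k) \<in> resonant M \<and> k \<le> N. a i * a l * cnj (a j) * h k)"
proof -
  let ?I = "{..M} \<times> {..M} \<times> {..M}"
  let ?t = "\<lambda>(i, l, j, k). a i * a l * cnj (a j) * h k"
  have "(\<Sum>k\<le>N. h k * cubic a M k)
      = (\<Sum>k\<le>N. \<Sum>(i, l, j)\<in>?I. if i + l = j + k then ?t (i, l, j, k) else 0)"
    unfolding cubic_def sum_distrib_left by (intro sum.cong refl) (auto split: prod.split)
  also have "\<dots> = (\<Sum>(k, i, l, j)\<in>{..N} \<times> ?I. if i + l = j + k then ?t (i, l, j, k) else 0)"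
    by (simp add: sum.cartesian_product split_def)
  also have "\<dots> = (\<Sum>(k, i, l, j) | (k, i, l, j) \<in> {..N} \<times> ?I \<and> i + l = j + k. ?t (i, l, j, k))"
    by (rule sum.mono_neutral_cong_right) (auto split: if_splits)
  also have "\<dots> = (\<Sum>q | (case q of (i, l, j, k) \<Rightarrow> (i, l, j, k) \<in> resonant M \<and> k \<le> N). ?t q)"
    by (rule sum.reindex_bij_witness[where i = "\<lambda>(i, l, j, k). (k, i, l, j)" and j = "\<lambda>(k, i, l, j). (i, l, j, k)"])
       (use assms in \<open>auto simp: resonant_def\<close>)
  finally show ?thesis by (simp add: split_def)
qed

lemma sum_mult_cubic_resonant:
  "(\<Sum>k\<le>N. h k * cubic a N k) = (\<Sum>(i, l, j, k)\<in>resonant N. a i * a l * cnj (a j) * h k)"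
  unfolding sum_mult_cubic[OF order_refl] by (rule sum.cong) (auto simp: resonant_def)

lemma sum_resonant_swap:
  "(\<Sum>(i, l, j, k)\<in>resonant N. f i l j k) = (\<Sum>(i, l, j, k)\<in>resonant N. f j k i l)"
  by (rule sum.reindex_bij_witness[where i = "\<lambda>(i, l, j, k). (j, k, i, l)" and j = "\<lambda>(i, l, j, k). (j, k, i, l)"])
     (auto simp: resonant_def)

lemma sum_resonant_swap_left:
  "(\<Sum>(i, l, j, k)\<in>resonant N. f i l j k) = (\<Sum>(i, l, j, k)\<in>resonant N. f l i j k)"
  by (rule sum.reindex_bij_witness[where i = "\<lambda>(i, l, j, k). (l, i, j, k)" and j = "\<lambda>(i, l, j, k). (l, i, j, k)"])
     (auto simp: resonant_def)

lemma sum_resonant_swap_right: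
  "(\<Sum>(i, l, j, k)\<in>resonant N. f i l j k) = (\<Sum>(i, l, j, k)\<in>resonant N. f i l k j)"
  by (rule sum.reindex_bij_witness[where i = "\<lambda>(i, l, j, k). (i, l, k, j)" and j = "\<lambda>(i, l, j, k). (i, l, k, j)"])
     (auto simp: resonant_def)

lemma cnj_sum_resonant:
  "cnj (\<Sum>(i, l, j, k)\<in>resonant N. f i l j k) = (\<Sum>(i, l, j, k)\<in>resonant N. cnj (f i l j k))"
  by (simp add: cnj_sum split_def)

lemma Im_eq_0_if_cnj_eq: "cnj z = z \<Longrightarrow> Im z = 0"
  by (simp add: complex_eq_iff)

lemma Im_mass_flux: "Im (\<Sum>k\<le>N. cnj (a k) * cubic a N k) = 0"
proof -
  let ?S = "\<Sum>(i, l, j, k)\<in>resonant N. a i * a l * cnj (a j) * cnj (a k)"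
  have "cnj ?S = ?S"
    unfolding cnj_sum_resonant by (subst (2) sum_resonant_swap) (simp add: mult_ac)
  then show ?thesis unfolding sum_mult_cubic_resonant by (rule Im_eq_0_if_cnj_eq)
qed

text \<open>By the symmetries the weights \<open>i\<close> and \<open>l\<close> give one sum \<open>I\<close>, and \<open>j\<close> and \<open>k\<close> give one sum \<open>K\<close>, its
  conjugate. The resonance condition \<open>i + l = j + k\<close> forces \<open>I = K\<close>, so \<open>K\<close> is real.\<close>

lemma Im_momentum_flux: "Im (\<Sum>k\<le>N. of_nat k * cnj (a k) * cubic a N k) = 0"
proof -
  let ?T = "\<lambda>i l j k. a i * a l * cnj (a j) * cnj (a k)"
  let ?J = "\<lambda>w. \<Sum>(i, l, j, k)\<in>resonant N. w i l j k * ?T i l j k"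
  define I where "I = ?J (\<lambda>i l j k. of_nat i)"
  define K where "K = ?J (\<lambda>i l j k. of_nat k)"
  have L: "?J (\<lambda>i l j k. of_nat l) = I"
    unfolding I_def by (subst sum_resonant_swap_left) (simp add: mult_ac)
  have J: "?J (\<lambda>i l j k. of_nat j) = K"
    unfolding K_def by (subst sum_resonant_swap_right) (simp add: mult_ac)
  have "I + ?J (\<lambda>i l j k. of_nat l) = ?J (\<lambda>i l j k. of_nat (i + l))"
    by (simp add: I_def split_def distrib_right flip: sum.distrib)
  also have "\<dots> = ?J (\<lambda>i l j k. of_nat (j + k))"
    by (rule sum.cong) (auto simp: resonant_def simp del: of_nat_add)
  also have "\<dots> = ?J (\<lambda>i l j k. of_nat j) + K"
    by (simp add: K_def split_def distrib_right flip: sum.distrib)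
  finally have "I = K" using L J by simp
  moreover have "cnj I = ?J (\<lambda>i l j k. of_nat j)"
    unfolding I_def cnj_sum_resonant by (subst sum_resonant_swap) (simp add: mult_ac)
  ultimately have "Im K = 0" using J by (intro Im_eq_0_if_cnj_eq) simp
  moreover have "(\<Sum>k\<le>N. of_nat k * cnj (a k) * cubic a N k) = K"
    unfolding K_def sum_mult_cubic_resonant by (simp add: mult_ac)
  ultimately show ?thesis by simp
qed

section \<open>Truncation errors\<close>

text \<open>Every truncation error below is a sum over resonant quadruples that are not contained in the box
  of size \<open>N\<close>. With the weight \<open>(1 + k)\<^sup>2\<close>, which dominates the weights of mass, momentum and kinetic
  energy, the sums over boxes increase and are bounded in \<open>H\<^sup>1\<close>. So the errors tend to zero, and they do so
  boundedly as long as the \<open>H\<^sup>1\<close> norm is bounded.\<close>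

definition resonant_weight :: "(nat \<Rightarrow> complex) \<Rightarrow> nat \<Rightarrow> real" where
  "resonant_weight a N = (\<Sum>(i, l, j, k)\<in>resonant N.
     (1 + real k)\<^sup>2 * (cmod (a i) * cmod (a l) * cmod (a j) * cmod (a k)))"

lemma incseq_resonant_weight: "incseq (resonant_weight a)"
  unfolding resonant_weight_def
  by (intro incseq_SucI sum_mono2 resonant_mono) auto

lemma sum_resonant_le:
  fixes f b :: "nat \<Rightarrow> real"
  assumes nn: "\<And>n. f n \<ge> 0" "\<And>n. b n \<ge> 0" and f: "(\<Sum>n\<le>N. f n) \<le> R" and b: "(\<Sum>n\<le>N. b n) \<le> S"
    and \<phi>: "inj_on \<phi> (resonant N)" "\<phi> ` resonant N \<subseteq> {..N} \<times> {..N} \<times> {..N}"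
  shows "(\<Sum>q\<in>resonant N. case \<phi> q of (x, y, z) \<Rightarrow> f x * b y * b z) \<le> R * S\<^sup>2"
proof -
  have "(\<Sum>q\<in>resonant N. case \<phi> q of (x, y, z) \<Rightarrow> f x * b y * b z)
      = (\<Sum>(x, y, z)\<in>\<phi> ` resonant N. f x * b y * b z)"
    by (simp add: sum.reindex[OF \<phi>(1)] o_def)
  also have "\<dots> \<le> (\<Sum>(x, y, z)\<in>{..N} \<times> {..N} \<times> {..N}. f x * b y * b z)"
    by (rule sum_mono2) (use \<phi>(2) nn in auto)
  also have "\<dots> = (\<Sum>n\<le>N. f n) * (\<Sum>n\<le>N. b n) * (\<Sum>n\<le>N. b n)"
    by (simp add: sum.cartesian_product[symmetric] flip: sum_distrib_left sum_distrib_right)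
  also have "\<dots> \<le> R * S * S"
    using sum_nonneg[of "{..N}" f] sum_nonneg[of "{..N}" b] nn f b by (intro mult_mono) auto
  finally show ?thesis by (simp add: power2_eq_square mult.assoc)
qed

text \<open>Since \<open>1 + k \<le> (1 + i) + (1 + l)\<close> on resonant quadruples, the two powers of \<open>1 + k\<close> can be shared
  between two different factors. These are then bounded in \<open>\<ell>\<^sup>2\<close> by the inequality of arithmetic and geometric means,
  and the other two are summed in \<open>\<ell>\<^sup>1\<close>; three of the indices determine the fourth.\<close>

lemma resonant_weight_le:
  assumes R: "(\<Sum>k\<le>N. (1 + real k)\<^sup>2 * (cmod (a k))\<^sup>2) \<le> R" and S: "(\<Sum>k\<le>N. cmod (a k)) \<le> S"
  shows "resonant_weight a N \<le> 2 * R * S\<^sup>2"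
proof -
  define b where "b k = cmod (a k)" for k
  define f where "f k = (1 + real k)\<^sup>2 * (b k)\<^sup>2" for k
  have nn: "f n \<ge> 0" "b n \<ge> 0" for n by (simp_all add: f_def b_def)
  have am: "(1 + real i) * (1 + real k) * (b i * b k) \<le> (f i + f k) / 2" for i k
  proof -
    have "2 * ((1 + real i) * (1 + real k) * (b i * b k)) = 2 * ((1 + real i) * b i) * ((1 + real k) * b k)"
      by (simp only: mult_ac)
    also have "\<dots> \<le> ((1 + real i) * b i)\<^sup>2 + ((1 + real k) * b k)\<^sup>2" by (rule sum_squares_bound)
    also have "\<dots> = f i + f k" by (simp only: f_def power_mult_distrib)
    finally have le: "2 * ((1 + real i) * (1 + real k) * (b i * b k)) \<le> f i + f k" .
    have half: "x \<le> y / 2" if "2 * x \<le> y" for x y :: real using that by simp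
    show ?thesis by (rule half[OF le])
  qed
  note bd = sum_resonant_le[of f b N R S, OF nn R[folded b_def, folded f_def] S[folded b_def]]
  have "resonant_weight a N \<le> (\<Sum>(i, l, j, k)\<in>resonant N.
      (f i * b l * b j + f k * b l * b j + f l * b i * b j + f k * b i * b j) / 2)"
    unfolding resonant_weight_def
  proof (rule sum_mono, clarify)
    fix i l j k assume "(i, l, j, k) \<in> resonant N"
    then have k: "1 + real k \<le> (1 + real i) + (1 + real l)" by (auto simp: resonant_def)
    have "(1 + real k)\<^sup>2 * (b i * b l * b j * b k) \<le> (1 + real k) * ((1 + real i) + (1 + real l)) * (b i * b l * b j * b k)"
      unfolding power2_eq_square by (intro mult_right_mono mult_left_mono k) (auto simp: b_def)
    also have "\<dots> = ((1 + real i) * (1 + real k) * (b i * b k)) * (b l * b j) + ((1 + real l) * (1 + real k) * (b l * b k)) * (b i * b j)"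
      by (simp add: algebra_simps)
    also have "\<dots> \<le> ((f i + f k) / 2) * (b l * b j) + ((f l + f k) / 2) * (b i * b j)"
      by (intro add_mono mult_right_mono am) (auto simp: nn)
    finally show "(1 + real k)\<^sup>2 * (cmod (a i) * cmod (a l) * cmod (a j) * cmod (a k))
        \<le> (f i * b l * b j + f k * b l * b j + f l * b i * b j + f k * b i * b j) / 2"
      by (simp add: b_def[symmetric] field_simps)
  qed
  also have "\<dots> = ((\<Sum>(i, l, j, k)\<in>resonant N. f i * b l * b j) + (\<Sum>(i, l, j, k)\<in>resonant N. f k * b l * b j)
      + (\<Sum>(i, l, j, k)\<in>resonant N. f l * b i * b j) + (\<Sum>(i, l, j, k)\<in>resonant N. f k * b i * b j)) / 2"
    by (simp add: split_def sum.distrib flip: sum_divide_distrib)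
  also have "\<dots> \<le> (R * S\<^sup>2 + R * S\<^sup>2 + R * S\<^sup>2 + R * S\<^sup>2) / 2"
    using bd[of "\<lambda>(i, l, j, k). (i, l, j)"] bd[of "\<lambda>(i, l, j, k). (k, l, j)"]
      bd[of "\<lambda>(i, l, j, k). (l, i, j)"] bd[of "\<lambda>(i, l, j, k). (k, i, j)"]
    by (intro divide_right_mono add_mono) (auto simp: split_def inj_on_def resonant_def)
  finally show ?thesis by simp
qed

lemma norm_weighted_cubic_diff_le:
  assumes "N \<le> M" and g: "\<And>k. \<bar>g k\<bar> \<le> G * (1 + real k)\<^sup>2"
  shows "cmod (\<Sum>k\<le>N. of_real (g k) * cnj (a k) * (cubic a M k - cubic a N k))
    \<le> G * (resonant_weight a M - resonant_weight a N)"
proof -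
  let ?A = "{(i, l, j, k). (i, l, j, k) \<in> resonant M \<and> k \<le> N}"
  let ?t = "\<lambda>(i, l, j, k). a i * a l * cnj (a j) * (of_real (g k) * cnj (a k))"
  let ?w = "\<lambda>(i, l, j, k). (1 + real k)\<^sup>2 * (cmod (a i) * cmod (a l) * cmod (a j) * cmod (a k))"
  have sub: "resonant N \<subseteq> ?A" using assms(1) by (auto simp: resonant_def)
  have fin: "finite ?A" by (rule finite_subset[OF _ finite_resonant[of M]]) auto
  have "(\<Sum>k\<le>N. of_real (g k) * cnj (a k) * (cubic a M k - cubic a N k)) = sum ?t ?A - sum ?t (resonant N)"
    using sum_mult_cubic[OF assms(1), of "\<lambda>k. of_real (g k) * cnj (a k)" a]
      sum_mult_cubic_resonant[of "\<lambda>k. of_real (g k) * cnj (a k)" a N]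
    by (simp add: right_diff_distrib sum_subtractf split_def)
  also have "\<dots> = sum ?t (?A - resonant N)"
    by (rule sum_diff[OF fin sub, symmetric])
  finally have eq: "cmod (\<Sum>k\<le>N. of_real (g k) * cnj (a k) * (cubic a M k - cubic a N k))
      = cmod (sum ?t (?A - resonant N))" by (rule arg_cong)
  have "cmod (sum ?t (?A - resonant N)) \<le> (\<Sum>q\<in>?A - resonant N. G * ?w q)"
  proof (rule sum_norm_le)
    fix q :: "nat \<times> nat \<times> nat \<times> nat"
    obtain i l j k where q: "q = (i, l, j, k)" by (cases q)
    show "cmod (?t q) \<le> G * ?w q"
      unfolding q using mult_right_mono[OF g[of k], of "cmod (a i) * cmod (a l) * cmod (a j) * cmod (a k)"]
      by (simp add: norm_mult mult_ac)
  qed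
  also have "\<dots> = G * sum ?w (?A - resonant N)" by (simp only: sum_distrib_left)
  also have "\<dots> \<le> G * sum ?w (resonant M - resonant N)"
  proof (rule mult_left_mono)
    show "0 \<le> G" using g[of 0] by simp
    show "sum ?w (?A - resonant N) \<le> sum ?w (resonant M - resonant N)"
      by (rule sum_mono2) auto
  qed
  also have "\<dots> = G * (resonant_weight a M - resonant_weight a N)"
    unfolding resonant_weight_def
    by (rule arg_cong[OF sum_diff[OF finite_resonant resonant_mono[OF assms(1)]]])
  finally show ?thesis unfolding eq .
qed

lemma cube_sum_eq:
  fixes b :: "nat \<Rightarrow> real"
  shows "(\<Sum>(i, l, j)\<in>{..N} \<times> {..N} \<times> {..N}. b i * b l * b j) = (\<Sum>k\<le>N. b k) ^ 3"
  by (simp add: sum.cartesian_product[symmetric] power3_eq_cube flip: sum_distrib_left sum_distrib_right)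

lemma norm_cubic_le: "cmod (cubic a N k) \<le> (\<Sum>k\<le>N. cmod (a k)) ^ 3"
  unfolding cubic_def cube_sum_eq[symmetric]
  by (rule sum_norm_le) (auto simp: norm_mult)

text \<open>A triple determines the frequency \<open>k\<close> that it contributes to, so summing over \<open>k\<close> counts each triple
  at most once.\<close>

lemma sum_norm_cubic_diff_le:
  assumes "N \<le> M"
  shows "(\<Sum>k\<le>N. cmod (cubic a M k - cubic a N k)) \<le> (\<Sum>k\<le>M. cmod (a k)) ^ 3 - (\<Sum>k\<le>N. cmod (a k)) ^ 3"
proof -
  let ?I = "\<lambda>N. {..N} \<times> {..N} \<times> {..N}"
  let ?b = "\<lambda>(i, l, j). cmod (a i) * cmod (a l) * cmod (a j)"
  let ?t = "\<lambda>k (i, l, j). if i + l = j + k then a i * a l * cnj (a j) else 0"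
  have sub: "?I N \<subseteq> ?I M" using assms by auto
  have "(\<Sum>k\<le>N. cmod (cubic a M k - cubic a N k)) = (\<Sum>k\<le>N. cmod (sum (?t k) (?I M - ?I N)))"
    unfolding cubic_def by (subst sum_diff[OF _ sub]) auto
  also have "\<dots> \<le> (\<Sum>k\<le>N. \<Sum>q\<in>?I M - ?I N. cmod (?t k q))"
    by (intro sum_mono norm_sum)
  also have "\<dots> = (\<Sum>q\<in>?I M - ?I N. \<Sum>k\<le>N. cmod (?t k q))" by (rule sum.swap)
  also have "\<dots> \<le> (\<Sum>q\<in>?I M - ?I N. ?b q)"
  proof (rule sum_mono)
    fix q :: "nat \<times> nat \<times> nat"
    obtain i l j where q: "q = (i, l, j)" by (cases q)
    have "(\<Sum>k\<le>N. cmod (?t k (i, l, j))) = (\<Sum>k\<in>{k\<in>{..N}. i + l = j + k}. ?b (i, l, j))"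
      by (rule sum.mono_neutral_cong_right) (auto simp: norm_mult)
    also have "\<dots> = real (card {k\<in>{..N}. i + l = j + k}) * ?b (i, l, j)" by simp
    also have "\<dots> \<le> 1 * ?b (i, l, j)"
    proof (rule mult_right_mono)
      have "card {k\<in>{..N}. i + l = j + k} \<le> card {i + l - j}" by (intro card_mono) auto
      then show "real (card {k\<in>{..N}. i + l = j + k}) \<le> 1" by simp
    qed simp
    finally show "(\<Sum>k\<le>N. cmod (?t k q)) \<le> ?b q" by (simp add: q)
  qed
  also have "\<dots> = sum ?b (?I M) - sum ?b (?I N)" by (rule sum_diff[OF _ sub]) auto
  finally show ?thesis by (simp only: cube_sum_eq)
qed

text \<open>The bounds for two truncations \<open>N \<le> M\<close> pass to the limit \<open>M \<rightarrow> \<infinity>\<close>, where \<open>cubic a M\<close> becomes the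
  coefficient sequence of the full nonlinearity. In this way no infinite sum over quadruples is
  ever formed.\<close>

lemma truncation_error_weighted:
  assumes R: "\<And>N. (\<Sum>k\<le>N. (1 + real k)\<^sup>2 * (cmod (a k))\<^sup>2) \<le> R" and S: "\<And>N. (\<Sum>k\<le>N. cmod (a k)) \<le> S"
    and f: "\<And>k. (\<lambda>M. cubic a M k) \<longlonglongrightarrow> f k"
    and g: "\<And>k. \<bar>g k\<bar> \<le> G * (1 + real k)\<^sup>2"
  shows "cmod (\<Sum>k\<le>N. of_real (g k) * cnj (a k) * (f k - cubic a N k)) \<le> G * (2 * R * S\<^sup>2)"
    and "(\<lambda>N. \<Sum>k\<le>N. of_real (g k) * cnj (a k) * (f k - cubic a N k)) \<longlonglongrightarrow> 0"
proof -
  obtain X where X: "resonant_weight a \<longlonglongrightarrow> X" "\<And>N. resonant_weight a N \<le> X"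
    using incseq_convergent[OF incseq_resonant_weight, of a "2 * R * S\<^sup>2"] resonant_weight_le[OF R S] by blast
  have G: "0 \<le> G" using g[of 0] by simp
  have XB: "X \<le> 2 * R * S\<^sup>2"
    by (rule LIMSEQ_le_const2[OF X(1)]) (use resonant_weight_le[OF R S] in blast)
  have le: "cmod (\<Sum>k\<le>N. of_real (g k) * cnj (a k) * (f k - cubic a N k)) \<le> G * (X - resonant_weight a N)" for N
  proof (rule tendsto_le[OF sequentially_bot])
    show "(\<lambda>M. G * (resonant_weight a M - resonant_weight a N)) \<longlonglongrightarrow> G * (X - resonant_weight a N)"
      by (intro tendsto_intros X(1))
    show "(\<lambda>M. cmod (\<Sum>k\<le>N. of_real (g k) * cnj (a k) * (cubic a M k - cubic a N k)))
        \<longlonglongrightarrow> cmod (\<Sum>k\<le>N. of_real (g k) * cnj (a k) * (f k - cubic a N k))"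
      by (intro tendsto_intros f)
    show "\<forall>\<^sub>F M in sequentially. cmod (\<Sum>k\<le>N. of_real (g k) * cnj (a k) * (cubic a M k - cubic a N k))
        \<le> G * (resonant_weight a M - resonant_weight a N)"
      using eventually_ge_at_top[of N] by eventually_elim (rule norm_weighted_cubic_diff_le[OF _ g])
  qed
  have "0 \<le> resonant_weight a N" for N
    unfolding resonant_weight_def by (intro sum_nonneg) auto
  then have "G * (X - resonant_weight a N) \<le> G * (2 * R * S\<^sup>2)"
    using XB by (intro mult_left_mono G) (smt (verit))
  with le show "cmod (\<Sum>k\<le>N. of_real (g k) * cnj (a k) * (f k - cubic a N k)) \<le> G * (2 * R * S\<^sup>2)"
    by (rule order_trans)
  have "(\<lambda>N. G * (X - resonant_weight a N)) \<longlonglongrightarrow> G * (X - X)" by (intro tendsto_intros X(1))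
  then have z: "(\<lambda>N. G * (X - resonant_weight a N)) \<longlonglongrightarrow> 0" by simp
  show "(\<lambda>N. \<Sum>k\<le>N. of_real (g k) * cnj (a k) * (f k - cubic a N k)) \<longlonglongrightarrow> 0"
    by (rule Lim_null_comparison[OF always_eventually[OF allI[OF le]] z])
qed

lemma truncation_error_cubic:
  assumes S: "\<And>N. (\<Sum>k\<le>N. cmod (a k)) \<le> S" and f: "\<And>k. (\<lambda>M. cubic a M k) \<longlonglongrightarrow> f k"
  shows "cmod (\<Sum>k\<le>N. cnj (cubic a N k) * (f k - cubic a N k)) \<le> S ^ 6"
    and "(\<lambda>N. \<Sum>k\<le>N. cnj (cubic a N k) * (f k - cubic a N k)) \<longlonglongrightarrow> 0"
proof -
  let ?s = "\<lambda>N. \<Sum>k\<le>N. cmod (a k)"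
  have "incseq ?s" by (intro incseq_SucI) simp
  then obtain s where s: "?s \<longlonglongrightarrow> s" "\<And>N. ?s N \<le> s" using incseq_convergent[of ?s S] S by blast
  have sS: "s \<le> S" by (rule LIMSEQ_le_const2[OF s(1)]) (use S in blast)
  have s0: "0 \<le> ?s N" for N by (simp add: sum_nonneg)
  have S0: "0 \<le> S" using s0[of 0] S[of 0] by linarith
  have le: "(\<Sum>k\<le>N. cmod (f k - cubic a N k)) \<le> s ^ 3 - ?s N ^ 3" for N
  proof (rule tendsto_le[OF sequentially_bot])
    show "(\<lambda>M. ?s M ^ 3 - ?s N ^ 3) \<longlonglongrightarrow> s ^ 3 - ?s N ^ 3" by (intro tendsto_intros s(1))
    show "(\<lambda>M. \<Sum>k\<le>N. cmod (cubic a M k - cubic a N k)) \<longlonglongrightarrow> (\<Sum>k\<le>N. cmod (f k - cubic a N k))"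
      by (intro tendsto_intros f)
    show "\<forall>\<^sub>F M in sequentially. (\<Sum>k\<le>N. cmod (cubic a M k - cubic a N k)) \<le> ?s M ^ 3 - ?s N ^ 3"
      using eventually_ge_at_top[of N] by eventually_elim (rule sum_norm_cubic_diff_le)
  qed
  have main: "cmod (\<Sum>k\<le>N. cnj (cubic a N k) * (f k - cubic a N k)) \<le> S ^ 3 * (s ^ 3 - ?s N ^ 3)" for N
  proof -
    have "cmod (\<Sum>k\<le>N. cnj (cubic a N k) * (f k - cubic a N k))
        \<le> (\<Sum>k\<le>N. S ^ 3 * cmod (f k - cubic a N k))"
      by (rule sum_norm_le)
         (auto simp: norm_mult intro!: mult_right_mono order_trans[OF norm_cubic_le] power_mono S s0)
    also have "\<dots> = S ^ 3 * (\<Sum>k\<le>N. cmod (f k - cubic a N k))" by (simp only: sum_distrib_left)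
    also have "\<dots> \<le> S ^ 3 * (s ^ 3 - ?s N ^ 3)" by (intro mult_left_mono le) (simp add: S0)
    finally show ?thesis .
  qed
  have "s ^ 3 - ?s N ^ 3 \<le> S ^ 3"
    using power_mono[OF sS order_trans[OF s0 s(2)], of 3] zero_le_power[OF s0[of N], of 3] by linarith
  then have "S ^ 3 * (s ^ 3 - ?s N ^ 3) \<le> S ^ 3 * S ^ 3" by (intro mult_left_mono) (simp_all add: S0)
  also have "\<dots> = S ^ 6" by (simp flip: power_add)
  finally show "cmod (\<Sum>k\<le>N. cnj (cubic a N k) * (f k - cubic a N k)) \<le> S ^ 6"
    using main[of N] by linarith
  have "(\<lambda>N. S ^ 3 * (s ^ 3 - ?s N ^ 3)) \<longlonglongrightarrow> S ^ 3 * (s ^ 3 - s ^ 3)" by (intro tendsto_intros s(1))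
  then have z: "(\<lambda>N. S ^ 3 * (s ^ 3 - ?s N ^ 3)) \<longlonglongrightarrow> 0" by simp
  show "(\<lambda>N. \<Sum>k\<le>N. cnj (cubic a N k) * (f k - cubic a N k)) \<longlonglongrightarrow> 0"
    by (rule Lim_null_comparison[OF always_eventually[OF allI[OF main]] z])
qed

section \<open>Conservation laws in the limit of large truncations\<close>

lemma sum_inverse_squares_le_2: "(\<Sum>k\<le>N. 1 / (1 + real k)\<^sup>2) \<le> 2"
proof -
  have "(\<Sum>k\<le>N. 1 / (1 + real k)\<^sup>2) \<le> 2 - 1 / (1 + real N)"
  proof (induction N)
    case (Suc N)
    have "1 / (2 + real N)\<^sup>2 \<le> 1 / ((1 + real N) * (2 + real N))"
      by (intro divide_left_mono) (auto simp: power2_eq_square intro!: mult_right_mono)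
    also have "\<dots> = 1 / (1 + real N) - 1 / (2 + real N)" by (simp add: field_simps)
    finally show ?case using Suc by simp
  qed simp
  also have "\<dots> \<le> 2" by simp
  finally show ?thesis .
qed

lemma sum_norm_le_weighted:
  assumes "(\<Sum>k\<le>N. (1 + real k)\<^sup>2 * (cmod (a k))\<^sup>2) \<le> R"
  shows "(\<Sum>k\<le>N. cmod (a k)) \<le> sqrt (2 * R)"
proof (rule real_le_rsqrt)
  have "(\<Sum>k\<le>N. cmod (a k))\<^sup>2 = (\<Sum>k\<le>N. 1 / (1 + real k) * ((1 + real k) * cmod (a k)))\<^sup>2"
    by (rule arg_cong[where f = "\<lambda>x. x\<^sup>2"], rule sum.cong) auto
  also have "\<dots> \<le> (\<Sum>k\<le>N. (1 / (1 + real k))\<^sup>2) * (\<Sum>k\<le>N. ((1 + real k) * cmod (a k))\<^sup>2)"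
    by (rule Cauchy_Schwarz_ineq_sum)
  also have "\<dots> \<le> 2 * R"
    using sum_inverse_squares_le_2[of N] assms
    by (intro mult_mono) (auto simp: power_divide power_mult_distrib intro!: sum_nonneg)
  finally show "(\<Sum>k\<le>N. cmod (a k))\<^sup>2 \<le> 2 * R" .
qed

text \<open>Approximate conservation laws: the fundamental theorem of calculus for the gauge integral
  makes every derivative integrable, so dominated convergence applies although nothing is known about the
  continuity of \<open>g' N\<close> in time.\<close>

lemma increment_tendsto_0:
  fixes g g' :: "nat \<Rightarrow> real \<Rightarrow> real"
  assumes "S \<le> T" and der: "\<And>N t. (g N has_real_derivative g' N t) (at t)"
    and bd: "\<And>N t. t \<in> {S..T} \<Longrightarrow> \<bar>g' N t\<bar> \<le> B"
    and lim: "\<And>t. t \<in> {S..T} \<Longrightarrow> (\<lambda>N. g' N t) \<longlonglongrightarrow> 0"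
  shows "(\<lambda>N. g N T - g N S) \<longlonglongrightarrow> 0"
proof -
  have FTC: "(g' N has_integral (g N T - g N S)) {S..T}" for N
    by (rule fundamental_theorem_of_calculus[OF \<open>S \<le> T\<close>])
       (use der in \<open>auto intro: has_vector_derivative_at_within simp: has_real_derivative_iff_has_vector_derivative\<close>)
  have "(\<lambda>N. integral {S..T} (g' N)) \<longlonglongrightarrow> integral {S..T} (\<lambda>_. 0)"
    by (rule dominated_convergence(2)[where h = "\<lambda>_. B"])
       (use FTC bd lim in \<open>auto simp: has_integral_integrable\<close>)
  then show ?thesis using integral_unique[OF FTC] by simp
qed

lemma increment_from_0_tendsto_0:
  fixes g :: "nat \<Rightarrow> real \<Rightarrow> real"
  assumes "\<And>S T. S \<le> T \<Longrightarrow> (\<lambda>N. g N T - g N S) \<longlonglongrightarrow> 0"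
  shows "(\<lambda>N. g N t - g N 0) \<longlonglongrightarrow> 0"
proof (cases "0 \<le> t")
  case False
  then have "(\<lambda>N. - (g N 0 - g N t)) \<longlonglongrightarrow> - 0" by (intro tendsto_minus assms) simp
  then show ?thesis by simp
qed (rule assms)

text \<open>The equation, mode by mode, with \<open>\<mu> = \<epsilon>\<^sup>\<alpha>\<close> and \<open>f t\<close> the coefficients of the full nonlinearity. The
  \<open>H\<^sup>1\<close> bound on compact time intervals serves to dominate the truncation errors.\<close>

locale mode_flow =
  fixes a f :: "real \<Rightarrow> nat \<Rightarrow> complex" and \<mu> :: real
  assumes mode_deriv: "\<And>t k. ((\<lambda>t. a t k) has_vector_derivative
      - \<i> * (of_real (\<mu> * (real k)\<^sup>2) * a t k + f t k)) (at t)"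
    and cubic_lim: "\<And>t k. (\<lambda>M. cubic (a t) M k) \<longlonglongrightarrow> f t k"
    and locally_bounded: "\<And>S T. \<exists>R. \<forall>t\<in>{S..T}. \<forall>N. (\<Sum>k\<le>N. (1 + real k)\<^sup>2 * (cmod (a t k))\<^sup>2) \<le> R"
    and \<mu>_nonneg: "0 \<le> \<mu>" and \<mu>_le_1: "\<mu> \<le> 1"
begin

definition velocity :: "real \<Rightarrow> nat \<Rightarrow> complex" where
  "velocity t k = - \<i> * (of_real (\<mu> * (real k)\<^sup>2) * a t k + f t k)"

lemma velocity_deriv: "((\<lambda>t. a t k) has_vector_derivative velocity t k) (at t)"
  unfolding velocity_def by (rule mode_deriv)

text \<open>The dispersive term rotates each mode and does not change its modulus.\<close>

lemma mode_norm_deriv: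
  "((\<lambda>t. (cmod (a t k))\<^sup>2) has_real_derivative 2 * Im (cnj (a t k) * f t k)) (at t)"
proof -
  have "((\<lambda>t. a t k * cnj (a t k)) has_vector_derivative
      (a t k * cnj (velocity t k) + velocity t k * cnj (a t k))) (at t)"
    by (intro has_vector_derivative_mult has_vector_derivative_cnj velocity_deriv)
  then have "((\<lambda>t. Re (a t k * cnj (a t k))) has_real_derivative
      Re (a t k * cnj (velocity t k) + velocity t k * cnj (a t k))) (at t)"
    by (simp only: has_vector_derivative_complex_iff)
  moreover have "Re (a t k * cnj (a t k)) = (cmod (a t k))\<^sup>2" for t
    by (simp flip: complex_norm_square)
  moreover have "Re (a t k * cnj (velocity t k) + velocity t k * cnj (a t k)) = 2 * Im (cnj (a t k) * f t k)"
    by (simp add: velocity_def algebra_simps)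
  ultimately show ?thesis by simp
qed

text \<open>The four factors of the summand contribute equally up to conjugation, by the symmetries of
  the resonant set.\<close>

lemma quartic_deriv:
  "((\<lambda>t. Re (\<Sum>k\<le>N. cnj (a t k) * cubic (a t) N k)) has_real_derivative
     4 * Re (\<Sum>k\<le>N. cnj (velocity t k) * cubic (a t) N k)) (at t)"
proof -
  let ?a = "a t" and ?v = "velocity t"
  let ?J = "\<lambda>w. \<Sum>(i, l, j, k)\<in>resonant N. w i l j k"
  define V where "V = (\<Sum>k\<le>N. cnj (?v k) * cubic ?a N k)"
  have V4: "?J (\<lambda>i l j k. ?a i * ?a l * cnj (?a j) * cnj (?v k)) = V"
    unfolding V_def sum_mult_cubic_resonant ..
  have V3: "?J (\<lambda>i l j k. ?a i * ?a l * cnj (?v j) * cnj (?a k)) = V"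
    unfolding V4[symmetric] by (subst sum_resonant_swap_right) (simp add: mult_ac)
  have V1: "?J (\<lambda>i l j k. ?v i * ?a l * cnj (?a j) * cnj (?a k)) = cnj V"
    unfolding V3[symmetric] cnj_sum_resonant by (subst sum_resonant_swap) (simp add: mult_ac)
  have V2: "?J (\<lambda>i l j k. ?a i * ?v l * cnj (?a j) * cnj (?a k)) = cnj V"
    unfolding V4[symmetric] cnj_sum_resonant by (subst sum_resonant_swap) (simp add: mult_ac)
  have "((\<lambda>t. ?J (\<lambda>i l j k. (a t i * a t l) * (cnj (a t j) * cnj (a t k)))) has_vector_derivative
      ?J (\<lambda>i l j k. (?a i * ?a l) * (cnj (?a j) * cnj (?v k) + cnj (?v j) * cnj (?a k))
        + (?a i * ?v l + ?v i * ?a l) * (cnj (?a j) * cnj (?a k)))) (at t)"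
    unfolding split_def
    by (intro has_vector_derivative_sum has_vector_derivative_mult has_vector_derivative_cnj velocity_deriv)
  also have "?J (\<lambda>i l j k. (?a i * ?a l) * (cnj (?a j) * cnj (?v k) + cnj (?v j) * cnj (?a k))
        + (?a i * ?v l + ?v i * ?a l) * (cnj (?a j) * cnj (?a k))) =
      ?J (\<lambda>i l j k. ?v i * ?a l * cnj (?a j) * cnj (?a k)) + ?J (\<lambda>i l j k. ?a i * ?v l * cnj (?a j) * cnj (?a k))
      + ?J (\<lambda>i l j k. ?a i * ?a l * cnj (?v j) * cnj (?a k)) + ?J (\<lambda>i l j k. ?a i * ?a l * cnj (?a j) * cnj (?v k))"
    unfolding sum.distrib[symmetric] by (rule sum.cong) (auto simp: algebra_simps)
  also have "\<dots> = 2 * (V + cnj V)" unfolding V1 V2 V3 V4 by simp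
  finally have "((\<lambda>t. Re (?J (\<lambda>i l j k. (a t i * a t l) * (cnj (a t j) * cnj (a t k))))) has_real_derivative
      Re (2 * (V + cnj V))) (at t)"
    by (simp only: has_vector_derivative_complex_iff)
  moreover have "(\<Sum>k\<le>N. cnj (a t k) * cubic (a t) N k)
      = ?J (\<lambda>i l j k. (a t i * a t l) * (cnj (a t j) * cnj (a t k)))" for t
    unfolding sum_mult_cubic_resonant by (simp only: mult.assoc)
  moreover have "Re (2 * (V + cnj V)) = 4 * Re V" by simp
  ultimately show ?thesis unfolding V_def[symmetric] by (simp only:)
qed

definition mass :: "nat \<Rightarrow> real \<Rightarrow> real" where
  "mass N t = (\<Sum>k\<le>N. (cmod (a t k))\<^sup>2)"

text \<open>The conserved quantity behind the theorem, for the truncation at \<open>N\<close>. With \<open>M\<close>, \<open>P\<close> and \<open>E\<close> the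
  mass, the momentum and the Hamiltonian \<open>\<mu> \<Sum>k\<^sup>2 |a\<^sub>k|\<^sup>2 + \<parallel>v\<parallel>\<^sup>4 / 2\<close> (the norm in \<open>L\<^sup>4\<close>), it is
  \<open>E - 2 \<mu> m P + (\<mu> m\<^sup>2 - 1) M + 1/2\<close>. The last summand below is half the mean of \<open>(|v|\<^sup>2 - 1)\<^sup>2\<close>.\<close>

definition energy :: "nat \<Rightarrow> nat \<Rightarrow> real \<Rightarrow> real" where
  "energy m N t = \<mu> * (\<Sum>k\<le>N. (real k - real m)\<^sup>2 * (cmod (a t k))\<^sup>2)
     + (Re (\<Sum>k\<le>N. cnj (a t k) * cubic (a t) N k) - 2 * mass N t + 1) / 2"

lemma bounds_on_interval:
  obtains R where "\<And>t N. t \<in> {S..T} \<Longrightarrow> (\<Sum>k\<le>N. (1 + real k)\<^sup>2 * (cmod (a t k))\<^sup>2) \<le> R"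
    "\<And>t N. t \<in> {S..T} \<Longrightarrow> (\<Sum>k\<le>N. cmod (a t k)) \<le> sqrt (2 * R)"
  using locally_bounded[of S T] sum_norm_le_weighted by metis

lemma mass_increment: "(\<lambda>N. mass N t - mass N 0) \<longlonglongrightarrow> 0"
proof (rule increment_from_0_tendsto_0)
  fix S T :: real assume "S \<le> T"
  define err where "err N t = (\<Sum>k\<le>N. of_real 1 * cnj (a t k) * (f t k - cubic (a t) N k))" for N t
  obtain R where R: "\<And>t N. t \<in> {S..T} \<Longrightarrow> (\<Sum>k\<le>N. (1 + real k)\<^sup>2 * (cmod (a t k))\<^sup>2) \<le> R"
    "\<And>t N. t \<in> {S..T} \<Longrightarrow> (\<Sum>k\<le>N. cmod (a t k)) \<le> sqrt (2 * R)"
    by (rule bounds_on_interval[of S T]) (rule that)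
  have g: "\<bar>1\<bar> \<le> 1 * (1 + real k)\<^sup>2" for k by (simp add: one_le_power)
  show "(\<lambda>N. mass N T - mass N S) \<longlonglongrightarrow> 0"
  proof (rule increment_tendsto_0[OF \<open>S \<le> T\<close>])
    fix N t
    have "(mass N has_real_derivative (\<Sum>k\<le>N. 2 * Im (cnj (a t k) * f t k))) (at t)"
      unfolding mass_def [abs_def] by (intro DERIV_sum mode_norm_deriv)
    moreover have "(\<Sum>k\<le>N. 2 * Im (cnj (a t k) * f t k)) = 2 * Im (\<Sum>k\<le>N. cnj (a t k) * f t k)"
      by (simp only: Im_sum sum_distrib_left)
    moreover have "Im (err N t) = Im (\<Sum>k\<le>N. cnj (a t k) * f t k) - Im (\<Sum>k\<le>N. cnj (a t k) * cubic (a t) N k)"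
      by (simp only: err_def of_real_1 mult_1_left right_diff_distrib sum_subtractf minus_complex.sel)
    ultimately have "(mass N has_real_derivative 2 * Im (err N t)) (at t)"
      using Im_mass_flux[of "a t" N] by (simp only: diff_0_right)
    then show "(mass N has_real_derivative 2 * Im (err N t)) (at t)" by simp
  next
    fix N t assume t: "t \<in> {S..T}"
    have "cmod (err N t) \<le> 1 * (2 * R * (sqrt (2 * R))\<^sup>2)"
      unfolding err_def by (rule truncation_error_weighted(1)[OF R[OF t] cubic_lim g])
    then show "\<bar>2 * Im (err N t)\<bar> \<le> 2 * (1 * (2 * R * (sqrt (2 * R))\<^sup>2))"
      using abs_Im_le_cmod[of "err N t"] by (simp only: abs_mult abs_numeral)
  next
    fix t assume t: "t \<in> {S..T}"
    have "(\<lambda>N. err N t) \<longlonglongrightarrow> 0"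
      unfolding err_def by (rule truncation_error_weighted(2)[OF R[OF t] cubic_lim g])
    then have "(\<lambda>N. 2 * Im (err N t)) \<longlonglongrightarrow> 2 * Im 0" by (intro tendsto_intros)
    then show "(\<lambda>N. 2 * Im (err N t)) \<longlonglongrightarrow> 0" by simp
  qed
qed

text \<open>In the derivative the kinetic contribution of the full nonlinearity \<open>f\<close> meets the dispersive
  contribution to the quartic term, which contains the truncated nonlinearity. They cancel up to
  the difference \<open>f - cubic\<close>: the weights \<open>1\<close> and \<open>k\<close> can be added freely because their fluxes
  vanish. What remains, \<open>err\<close> and \<open>cerr\<close>, are truncation errors.\<close>

lemma energy_increment: "(\<lambda>N. energy m N t - energy m N 0) \<longlonglongrightarrow> 0"
proof (rule increment_from_0_tendsto_0)
  fix S T :: real assume "S \<le> T"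
  define g where "g k = \<mu> * (real k - real m)\<^sup>2 - 1" for k
  define err where "err N t = (\<Sum>k\<le>N. of_real (g k) * cnj (a t k) * (f t k - cubic (a t) N k))" for N t
  define cerr where "cerr N t = (\<Sum>k\<le>N. cnj (cubic (a t) N k) * (f t k - cubic (a t) N k))" for N t
  obtain R where R: "\<And>t N. t \<in> {S..T} \<Longrightarrow> (\<Sum>k\<le>N. (1 + real k)\<^sup>2 * (cmod (a t k))\<^sup>2) \<le> R"
    "\<And>t N. t \<in> {S..T} \<Longrightarrow> (\<Sum>k\<le>N. cmod (a t k)) \<le> sqrt (2 * R)"
    by (rule bounds_on_interval[of S T]) (rule that)
  have g: "\<bar>g k\<bar> \<le> (1 + (1 + real m)\<^sup>2) * (1 + real k)\<^sup>2" for k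
  proof -
    have "\<bar>real k - real m\<bar> \<le> (1 + real m) * (1 + real k)" by (simp add: algebra_simps abs_le_iff)
    then have "(real k - real m)\<^sup>2 \<le> (1 + real m)\<^sup>2 * (1 + real k)\<^sup>2"
      using power_mono[of "\<bar>real k - real m\<bar>" "(1 + real m) * (1 + real k)" 2]
      by (simp add: power_mult_distrib)
    moreover have "\<mu> * (real k - real m)\<^sup>2 \<le> (real k - real m)\<^sup>2"
      using \<mu>_le_1 by (intro mult_left_le_one_le) (auto simp: \<mu>_nonneg)
    moreover have "0 \<le> \<mu> * (real k - real m)\<^sup>2" using \<mu>_nonneg by simp
    moreover have "1 \<le> (1 + real k)\<^sup>2" by (simp add: one_le_power)
    ultimately show ?thesis unfolding g_def distrib_right by linarith
  qed
  show "(\<lambda>N. energy m N T - energy m N S) \<longlonglongrightarrow> 0"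
  proof (rule increment_tendsto_0[OF \<open>S \<le> T\<close>])
    fix N t
    let ?c = "cubic (a t) N" and ?a = "a t" and ?f = "f t"
    have eq: "energy m N = (\<lambda>t. (\<Sum>k\<le>N. g k * (cmod (a t k))\<^sup>2)
        + Re (\<Sum>k\<le>N. cnj (a t k) * cubic (a t) N k) / 2 + 1 / 2)"
    proof
      fix t
      have "(\<Sum>k\<le>N. g k * (cmod (a t k))\<^sup>2)
          = \<mu> * (\<Sum>k\<le>N. (real k - real m)\<^sup>2 * (cmod (a t k))\<^sup>2) - mass N t"
        by (simp add: g_def mass_def left_diff_distrib sum_subtractf sum_distrib_left mult.assoc)
      then show "energy m N t = (\<Sum>k\<le>N. g k * (cmod (a t k))\<^sup>2)
        + Re (\<Sum>k\<le>N. cnj (a t k) * cubic (a t) N k) / 2 + 1 / 2"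
        unfolding energy_def by simp
    qed
    have D: "(energy m N has_real_derivative
        (\<Sum>k\<le>N. g k * (2 * Im (cnj (?a k) * ?f k))) + 4 * Re (\<Sum>k\<le>N. cnj (velocity t k) * ?c k) / 2 + 0) (at t)"
      unfolding eq
      by (intro DERIV_add DERIV_sum DERIV_cmult DERIV_cdivide DERIV_const mode_norm_deriv quartic_deriv)
    \<comment> \<open>The weight of the quartic term differs from \<open>g\<close> by a combination of the weights \<open>1\<close> and \<open>k\<close>.\<close>
    have "of_real (\<mu> * (real k)\<^sup>2) = complex_of_real (g k) + of_real (1 - \<mu> * (real m)\<^sup>2) + of_real (2 * \<mu> * real m) * of_nat k" for k
      by (simp add: g_def power2_eq_square algebra_simps)
    then have flux: "Im (\<Sum>k\<le>N. of_real (\<mu> * (real k)\<^sup>2) * cnj (?a k) * ?c k)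
        = Im (\<Sum>k\<le>N. of_real (g k) * cnj (?a k) * ?c k)
          + Im (of_real (1 - \<mu> * (real m)\<^sup>2) * (\<Sum>k\<le>N. cnj (?a k) * ?c k))
          + Im (of_real (2 * \<mu> * real m) * (\<Sum>k\<le>N. of_nat k * cnj (?a k) * ?c k))"
      by (simp only: distrib_right sum.distrib plus_complex.sel sum_distrib_left mult.assoc)
    have "Re (\<Sum>k\<le>N. cnj (velocity t k) * ?c k)
        = - Im (\<Sum>k\<le>N. of_real (\<mu> * (real k)\<^sup>2) * cnj (?a k) * ?c k) - Im (\<Sum>k\<le>N. cnj (?f k) * ?c k)"
      unfolding Re_sum Im_sum sum_negf[symmetric] sum_subtractf[symmetric]
      by (rule sum.cong) (simp_all add: velocity_def algebra_simps)
    also have "\<dots> = - Im (\<Sum>k\<le>N. of_real (g k) * cnj (?a k) * ?c k) + Im (cerr N t)"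
    proof -
      have "- Im (\<Sum>k\<le>N. cnj (?f k) * ?c k) = Im (cerr N t)"
        unfolding cerr_def Im_sum sum_negf[symmetric]
        by (rule sum.cong) (simp_all add: algebra_simps)
      moreover have "Im (of_real r * z) = r * Im z" for r z by simp
      ultimately show ?thesis
        using flux by (simp only: Im_mass_flux Im_momentum_flux mult_zero_right add_0_right diff_conv_add_uminus)
    qed
    finally have Re: "Re (\<Sum>k\<le>N. cnj (velocity t k) * ?c k) = - Im (\<Sum>k\<le>N. of_real (g k) * cnj (?a k) * ?c k) + Im (cerr N t)" .
    have gf: "(\<Sum>k\<le>N. g k * (2 * Im (cnj (?a k) * ?f k))) = 2 * Im (\<Sum>k\<le>N. of_real (g k) * cnj (?a k) * ?f k)"
      unfolding Im_sum sum_distrib_left by (rule sum.cong) (simp_all add: algebra_simps)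
    have err: "Im (err N t) = Im (\<Sum>k\<le>N. of_real (g k) * cnj (?a k) * ?f k) - Im (\<Sum>k\<le>N. of_real (g k) * cnj (?a k) * ?c k)"
      by (simp only: err_def right_diff_distrib sum_subtractf minus_complex.sel)
    have "2 * A + 4 * (- B + X) / 2 + 0 = 2 * (A - B) + 2 * X" for A B X :: real by simp
    then show "(energy m N has_real_derivative 2 * Im (err N t) + 2 * Im (cerr N t)) (at t)"
      using D unfolding gf Re err by (simp only:)
  next
    fix N t assume t: "t \<in> {S..T}"
    have "cmod (err N t) \<le> (1 + (1 + real m)\<^sup>2) * (2 * R * (sqrt (2 * R))\<^sup>2)"
      unfolding err_def by (rule truncation_error_weighted(1)[OF R[OF t] cubic_lim g])
    moreover have "cmod (cerr N t) \<le> sqrt (2 * R) ^ 6"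
      unfolding cerr_def by (rule truncation_error_cubic(1)[OF R(2)[OF t] cubic_lim])
    ultimately show "\<bar>2 * Im (err N t) + 2 * Im (cerr N t)\<bar>
        \<le> 2 * ((1 + (1 + real m)\<^sup>2) * (2 * R * (sqrt (2 * R))\<^sup>2)) + 2 * sqrt (2 * R) ^ 6"
      using abs_Im_le_cmod[of "err N t"] abs_Im_le_cmod[of "cerr N t"] by (simp only: abs_le_iff) linarith
  next
    fix t assume t: "t \<in> {S..T}"
    have "(\<lambda>N. err N t) \<longlonglongrightarrow> 0"
      unfolding err_def by (rule truncation_error_weighted(2)[OF R[OF t] cubic_lim g])
    moreover have "(\<lambda>N. cerr N t) \<longlonglongrightarrow> 0"
      unfolding cerr_def by (rule truncation_error_cubic(2)[OF R(2)[OF t] cubic_lim])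
    ultimately have "(\<lambda>N. 2 * Im (err N t) + 2 * Im (cerr N t)) \<longlonglongrightarrow> 2 * Im 0 + 2 * Im 0"
      by (intro tendsto_intros)
    then show "(\<lambda>N. 2 * Im (err N t) + 2 * Im (cerr N t)) \<longlonglongrightarrow> 0" by simp
  qed
qed

end

section \<open>Coercivity and initial size of the energy\<close>

lemma mean_of_real_bounds:
  fixes h :: "real \<Rightarrow> real"
  assumes "h \<in> borel_measurable borel" "\<And>x. 0 \<le> h x" "\<And>x. h x \<le> B"
  shows "0 \<le> Re (mean (\<lambda>x. of_real (h x)))" "Re (mean (\<lambda>x. of_real (h x))) \<le> B"
proof -
  have int: "integrable circle h"
  proof (rule finite_measure.integrable_const_bound[OF finite_measure_circle])
    show "h \<in> borel_measurable circle" by (rule measurable_circle[OF assms(1)])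
    show "AE x in circle. norm (h x) \<le> B" by (rule AE_I2) (simp add: abs_of_nonneg assms)
  qed
  have eq: "Re (mean (\<lambda>x. of_real (h x))) = integral\<^sup>L circle h / (2 * pi)"
    unfolding mean_def integral_complex_of_real by (simp only: of_real_divide[symmetric] Re_complex_of_real)
  show "0 \<le> Re (mean (\<lambda>x. of_real (h x)))"
    unfolding eq by (intro divide_nonneg_nonneg integral_nonneg_AE AE_I2 assms) simp
  have "integral\<^sup>L circle h \<le> (\<integral>x. B \<partial>circle)"
    by (intro integral_mono int finite_measure.integrable_const[OF finite_measure_circle] assms)
  also have "\<dots> = B * (2 * pi)" by (simp add: measure_circle)
  finally show "Re (mean (\<lambda>x. of_real (h x))) \<le> B"
    unfolding eq by (simp add: pos_divide_le_eq)
qed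

lemma defect_measurable: "(\<lambda>x. ((cmod (partial_sum b N x))\<^sup>2 - 1)\<^sup>2) \<in> borel_measurable borel"
  by (intro borel_measurable_power borel_measurable_diff borel_measurable_const
      measurable_compose[OF partial_sum_measurable borel_measurable_norm])

context mode_flow
begin

lemma quartic_defect:
  "complex_of_real (Re (\<Sum>k\<le>N. cnj (a t k) * cubic (a t) N k) - 2 * mass N t + 1)
    = of_real (Re (mean (\<lambda>x. of_real (((cmod (partial_sum (a t) N x))\<^sup>2 - 1)\<^sup>2))))"
  unfolding mean_norm_square_defect mass_def by simp

text \<open>Coercivity: the quartic part of the energy is half the mean of a square.\<close>

lemma energy_ge: "\<mu> * (\<Sum>k\<le>N. (real k - real m)\<^sup>2 * (cmod (a t k))\<^sup>2) \<le> energy m N t"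
proof -
  have b: "\<bar>((cmod (partial_sum (a t) N x))\<^sup>2 - 1)\<bar> \<le> (\<Sum>k\<le>N. cmod (a t k))\<^sup>2 + 1" for x
    using power_mono[OF norm_partial_sum_le[of "a t" N x] norm_ge_zero, of 2]
      zero_le_power2[of "cmod (partial_sum (a t) N x)"] by linarith
  have "0 \<le> Re (mean (\<lambda>x. of_real (((cmod (partial_sum (a t) N x))\<^sup>2 - 1)\<^sup>2)))"
  proof (rule mean_of_real_bounds(1))
    show "((cmod (partial_sum (a t) N x))\<^sup>2 - 1)\<^sup>2 \<le> ((\<Sum>k\<le>N. cmod (a t k))\<^sup>2 + 1)\<^sup>2" for x
      using power_mono[OF b, of x 2] by simp
  qed (rule defect_measurable, simp)
  then show ?thesis
    using quartic_defect[of t N] unfolding energy_def of_real_eq_iff by simp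
qed

text \<open>The mode \<open>m\<close> has no kinetic weight, so the kinetic part sees only the perturbation \<open>d\<close> and is quadratic
  in \<open>\<epsilon>\<close>. The quartic part is quadratic because \<open>H\<^sup>1\<close> controls the supremum: \<open>|v|\<close> is within \<open>2 \<epsilon>\<close> of 1, so
  \<open>|v|\<^sup>2 - 1\<close> is at most \<open>8 \<epsilon>\<close>. The constant is \<open>33 + m\<^sup>2 = (1 + m\<^sup>2) + 64/2\<close>.\<close>

lemma energy_initial_le:
  assumes eps: "0 < \<epsilon>" "\<epsilon> < 1" and "m \<le> N"
    and init: "\<And>N. (\<Sum>k\<le>N. (1 + (real k)\<^sup>2) * (cmod (a 0 k - (if k = m then 1 else 0)))\<^sup>2) \<le> \<epsilon>\<^sup>2"
  shows "energy m N 0 \<le> (33 + (real m)\<^sup>2) * \<epsilon>\<^sup>2"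
proof -
  define d where "d k = a 0 k - (if k = m then 1 else 0)" for k
  note init = init[folded d_def]
  have "(\<Sum>k\<le>N. (real k - real m)\<^sup>2 * (cmod (a 0 k))\<^sup>2)
      \<le> (\<Sum>k\<le>N. (1 + (real m)\<^sup>2) * ((1 + (real k)\<^sup>2) * (cmod (d k))\<^sup>2))"
  proof (rule sum_mono)
    fix k
    have "(real k - real m)\<^sup>2 \<le> (1 + (real m)\<^sup>2) * (1 + (real k)\<^sup>2)"
      using zero_le_power2[of "real k * real m + 1"] by (simp add: power2_eq_square algebra_simps)
    then have "(real k - real m)\<^sup>2 * (cmod (d k))\<^sup>2 \<le> (1 + (real m)\<^sup>2) * (1 + (real k)\<^sup>2) * (cmod (d k))\<^sup>2"
      by (rule mult_right_mono) simp
    then show "(real k - real m)\<^sup>2 * (cmod (a 0 k))\<^sup>2 \<le> (1 + (real m)\<^sup>2) * ((1 + (real k)\<^sup>2) * (cmod (d k))\<^sup>2)"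
      by (cases "k = m") (simp_all add: d_def mult.assoc)
  qed
  also have "\<dots> = (1 + (real m)\<^sup>2) * (\<Sum>k\<le>N. (1 + (real k)\<^sup>2) * (cmod (d k))\<^sup>2)"
    by (simp only: sum_distrib_left)
  also have "\<dots> \<le> (1 + (real m)\<^sup>2) * \<epsilon>\<^sup>2"
    by (intro mult_left_mono init) simp
  finally have kin: "(\<Sum>k\<le>N. (real k - real m)\<^sup>2 * (cmod (a 0 k))\<^sup>2) \<le> (1 + (real m)\<^sup>2) * \<epsilon>\<^sup>2" .
  have "\<mu> * (\<Sum>k\<le>N. (real k - real m)\<^sup>2 * (cmod (a 0 k))\<^sup>2) \<le> 1 * ((1 + (real m)\<^sup>2) * \<epsilon>\<^sup>2)"
    by (intro mult_mono \<mu>_le_1 kin) (auto intro!: sum_nonneg)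
  moreover have "Re (\<Sum>k\<le>N. cnj (a 0 k) * cubic (a 0) N k) - 2 * mass N 0 + 1 \<le> 64 * \<epsilon>\<^sup>2"
  proof -
    have "(\<Sum>k\<le>N. (1 + real k)\<^sup>2 * (cmod (d k))\<^sup>2) \<le> (\<Sum>k\<le>N. 2 * ((1 + (real k)\<^sup>2) * (cmod (d k))\<^sup>2))"
    proof (rule sum_mono)
      fix k
      have "(1 + real k)\<^sup>2 \<le> 2 * (1 + (real k)\<^sup>2)"
        using zero_le_power2[of "real k - 1"] by (simp add: power2_eq_square algebra_simps)
      from mult_right_mono[OF this, of "(cmod (d k))\<^sup>2"]
      show "(1 + real k)\<^sup>2 * (cmod (d k))\<^sup>2 \<le> 2 * ((1 + (real k)\<^sup>2) * (cmod (d k))\<^sup>2)"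
        by (simp only: mult.assoc zero_le_power2)
    qed
    also have "\<dots> \<le> 2 * \<epsilon>\<^sup>2" using init[of N] by (simp flip: sum_distrib_left)
    finally have "(\<Sum>k\<le>N. cmod (d k)) \<le> sqrt (2 * (2 * \<epsilon>\<^sup>2))" by (rule sum_norm_le_weighted)
    also have "\<dots> = 2 * \<epsilon>" using eps by (simp add: real_sqrt_mult)
    finally have dsum: "(\<Sum>k\<le>N. cmod (d k)) \<le> 2 * \<epsilon>" .
    have h: "((cmod (partial_sum (a 0) N x))\<^sup>2 - 1)\<^sup>2 \<le> 64 * \<epsilon>\<^sup>2" for x
    proof -
      let ?P = "partial_sum (a 0) N x"
      have "partial_sum d N x = ?P - (\<Sum>k\<le>N. if k = m then wave (int k) x else 0)"
        unfolding partial_sum_def sum_subtractf[symmetric]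
        by (rule sum.cong) (auto simp: d_def algebra_simps)
      then have "partial_sum d N x = ?P - wave (int m) x" using \<open>m \<le> N\<close> by simp
      then have "cmod (?P - wave (int m) x) \<le> 2 * \<epsilon>"
        using norm_partial_sum_le[of d N x] dsum by simp
      then have *: "\<bar>cmod ?P - 1\<bar> \<le> 2 * \<epsilon>"
        using norm_triangle_ineq3[of ?P "wave (int m) x"] by simp
      have "\<bar>(cmod ?P)\<^sup>2 - 1\<bar> = \<bar>cmod ?P - 1\<bar> * \<bar>cmod ?P + 1\<bar>"
        by (simp only: abs_mult[symmetric]) (simp add: power2_eq_square algebra_simps)
      also have "\<dots> \<le> (2 * \<epsilon>) * 4"
        using * eps norm_ge_zero[of ?P] by (intro mult_mono) linarith+
      finally have "\<bar>(cmod ?P)\<^sup>2 - 1\<bar> \<le> 8 * \<epsilon>" by simp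
      from power_mono[OF this, of 2] show ?thesis by (simp add: power_mult_distrib)
    qed
    have "Re (mean (\<lambda>x. of_real (((cmod (partial_sum (a 0) N x))\<^sup>2 - 1)\<^sup>2))) \<le> 64 * \<epsilon>\<^sup>2"
      by (rule mean_of_real_bounds(2)[OF defect_measurable _ h]) simp
    then show ?thesis using quartic_defect[of 0 N] unfolding of_real_eq_iff by simp
  qed
  moreover have "x + y / 2 \<le> (33 + z) * e" if "x \<le> 1 * ((1 + z) * e)" "y \<le> 64 * e" for x y z e :: real
    using that by (simp add: algebra_simps)
  ultimately show ?thesis unfolding energy_def by blast
qed

lemma mass_initial:
  assumes eps: "0 < \<epsilon>" "\<epsilon> < 1" and "m \<le> N"
    and init: "\<And>N. (\<Sum>k\<le>N. (1 + (real k)\<^sup>2) * (cmod (a 0 k - (if k = m then 1 else 0)))\<^sup>2) \<le> \<epsilon>\<^sup>2"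
  shows "\<bar>mass N 0 - 1\<bar> \<le> 3 * \<epsilon>"
proof -
  define d where "d k = a 0 k - (if k = m then 1 else 0)" for k
  have D: "(\<Sum>k\<le>N. (cmod (d k))\<^sup>2) \<le> \<epsilon>\<^sup>2"
  proof (rule order_trans[OF sum_mono init[of N, folded d_def]])
    fix k show "(cmod (d k))\<^sup>2 \<le> (1 + (real k)\<^sup>2) * (cmod (d k))\<^sup>2"
      by (simp add: distrib_right)
  qed
  have "(cmod (d m))\<^sup>2 \<le> (\<Sum>k\<le>N. (cmod (d k))\<^sup>2)"
    by (rule member_le_sum) (use \<open>m \<le> N\<close> in auto)
  also note D
  finally have dm: "cmod (d m) \<le> \<epsilon>"
    by (rule power2_le_imp_le) (simp add: eps less_imp_le)
  have "mass N 0 = (\<Sum>k\<le>N. (cmod (d k))\<^sup>2 + (if k = m then 2 * Re (d m) + 1 else 0))"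
  proof -
    have "(cmod z)\<^sup>2 = (cmod (z - 1))\<^sup>2 + (2 * Re (z - 1) + 1)" for z
      unfolding cmod_power2 by (simp add: power2_eq_square algebra_simps)
    from this[of "a 0 m"] show ?thesis
      unfolding mass_def by (intro sum.cong refl) (simp add: d_def)
  qed
  also have "\<dots> = (\<Sum>k\<le>N. (cmod (d k))\<^sup>2) + 2 * Re (d m) + 1"
    using \<open>m \<le> N\<close> by (simp add: sum.distrib)
  finally have "mass N 0 - 1 = (\<Sum>k\<le>N. (cmod (d k))\<^sup>2) + 2 * Re (d m)" by simp
  moreover have "0 \<le> (\<Sum>k\<le>N. (cmod (d k))\<^sup>2)" by (intro sum_nonneg) simp
  moreover have "\<epsilon>\<^sup>2 \<le> \<epsilon>" using eps by (simp add: power2_eq_square mult_left_le)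
  ultimately show ?thesis using D dm abs_Re_le_cmod[of "d m"] unfolding abs_le_iff by linarith
qed

text \<open>The energy stays of order \<open>\<epsilon>\<^sup>2\<close>, so dividing its kinetic part by \<open>\<mu>\<close> bounds all modes other than
  \<open>m\<close> by \<open>\<epsilon>\<^sup>2 / \<mu> = \<delta>\<^sup>2\<close>. The mass stays within \<open>3 \<epsilon>\<close> of 1, and what the other modes do not
  carry must sit in the mode \<open>m\<close>.\<close>

lemma orbital_bounds:
  assumes eps: "0 < \<epsilon>" "\<epsilon> < 1" and \<delta>: "\<epsilon> \<le> \<delta>" "\<delta> \<le> 1" "\<mu> * \<delta>\<^sup>2 = \<epsilon>\<^sup>2"
    and init: "\<And>N. (\<Sum>k\<le>N. (1 + (real k)\<^sup>2) * (cmod (a 0 k - (if k = m then 1 else 0)))\<^sup>2) \<le> \<epsilon>\<^sup>2"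
  shows "(\<Sum>k\<le>N. (real k - real m)\<^sup>2 * (cmod (a t k))\<^sup>2) \<le> (33 + (real m)\<^sup>2) * \<delta>\<^sup>2"
    and "\<bar>cmod (a t m) - 1\<bar> \<le> (36 + (real m)\<^sup>2) * \<delta>"
proof -
  define K where "K = 33 + (real m)\<^sup>2"
  let ?G = "\<lambda>N. \<Sum>k\<le>N. (real k - real m)\<^sup>2 * (cmod (a t k))\<^sup>2"
  have \<mu>pos: "0 < \<mu>" using \<delta>(3) eps \<mu>_nonneg by (cases "\<mu> = 0") auto
  have G: "?G N \<le> K * \<delta>\<^sup>2" for N
  proof -
    \<comment> \<open>Keep the sum on the left at \<open>N\<close> and let the truncation \<open>M\<close> of the energy tend to infinity.\<close>
    have "\<mu> * ?G N \<le> K * \<epsilon>\<^sup>2"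
    proof (rule tendsto_le[OF sequentially_bot])
      show "(\<lambda>M. K * \<epsilon>\<^sup>2 + (energy m M t - energy m M 0)) \<longlonglongrightarrow> K * \<epsilon>\<^sup>2"
        using tendsto_add[OF tendsto_const energy_increment, of "K * \<epsilon>\<^sup>2" m t] by simp
      show "(\<lambda>M. \<mu> * ?G N) \<longlonglongrightarrow> \<mu> * ?G N" by simp
      show "\<forall>\<^sub>F M in sequentially. \<mu> * ?G N \<le> K * \<epsilon>\<^sup>2 + (energy m M t - energy m M 0)"
        using eventually_ge_at_top[of "max m N"]
      proof eventually_elim
        case (elim M)
        have "?G N \<le> ?G M" by (rule sum_mono2) (use elim in auto)
        then have "\<mu> * ?G N \<le> \<mu> * ?G M" using \<mu>_nonneg by (rule mult_left_mono)
        moreover have "energy m M 0 \<le> K * \<epsilon>\<^sup>2"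
          unfolding K_def by (rule energy_initial_le[OF eps _ init]) (use elim in auto)
        ultimately show ?case using energy_ge[where m = m and N = M and t = t] by linarith
      qed
    qed
    also have "\<dots> = \<mu> * (K * \<delta>\<^sup>2)" by (simp flip: \<delta>(3))
    finally show ?thesis using \<mu>pos by (simp only: mult_le_cancel_left_pos)
  qed
  then show "?G N \<le> (33 + (real m)\<^sup>2) * \<delta>\<^sup>2" unfolding K_def .
  let ?c = "(cmod (a t m))\<^sup>2"
  have K0: "0 \<le> K" by (simp add: K_def)
  have mass_near: "?c \<le> mass N t \<and> mass N t \<le> ?c + K * \<delta>\<^sup>2" if "m \<le> N" for N
  proof
    show "?c \<le> mass N t" unfolding mass_def by (rule member_le_sum) (use that in auto)
    have "mass N t \<le> (\<Sum>k\<le>N. (if k = m then ?c else 0) + (real k - real m)\<^sup>2 * (cmod (a t k))\<^sup>2)"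
      unfolding mass_def
    proof (rule sum_mono)
      fix k
      have "1 \<le> (real k - real m)\<^sup>2" if "k \<noteq> m"
      proof -
        have "1 \<le> \<bar>real k - real m\<bar>" using that by linarith
        from power_mono[OF this, of 2] show ?thesis by simp
      qed
      then show "(cmod (a t k))\<^sup>2 \<le> (if k = m then ?c else 0) + (real k - real m)\<^sup>2 * (cmod (a t k))\<^sup>2"
        by (auto simp: mult_right_mono[of 1 _ "(cmod (a t k))\<^sup>2", simplified])
    qed
    also have "\<dots> = ?c + ?G N" using that by (simp add: sum.distrib)
    finally show "mass N t \<le> ?c + K * \<delta>\<^sup>2" using G[of N] by simp
  qed
  have lim: "(\<lambda>M. 3 * \<epsilon> + K * \<delta>\<^sup>2 + \<bar>mass M t - mass M 0\<bar>) \<longlonglongrightarrow> 3 * \<epsilon> + K * \<delta>\<^sup>2"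
    using tendsto_add[OF tendsto_const tendsto_rabs[OF mass_increment], of "3 * \<epsilon> + K * \<delta>\<^sup>2" t] by simp
  have "\<bar>?c - 1\<bar> \<le> 3 * \<epsilon> + K * \<delta>\<^sup>2"
  proof (rule tendsto_le[OF sequentially_bot lim tendsto_const])
    show "\<forall>\<^sub>F M in sequentially. \<bar>?c - 1\<bar> \<le> 3 * \<epsilon> + K * \<delta>\<^sup>2 + \<bar>mass M t - mass M 0\<bar>"
      using eventually_ge_at_top[of m]
    proof eventually_elim
      case (elim M)
      have "0 \<le> K * \<delta>\<^sup>2" using K0 by simp
      then show ?case
        using mass_initial[OF eps elim init] mass_near[OF elim] by linarith
    qed
  qed
  also have "\<dots> \<le> 3 * \<delta> + K * \<delta>"
    using \<delta> eps K0 by (intro add_mono mult_left_mono) (auto simp: power2_eq_square mult_left_le)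
  finally have c: "\<bar>?c - 1\<bar> \<le> (36 + (real m)\<^sup>2) * \<delta>" by (simp add: K_def algebra_simps)
  have "\<bar>cmod (a t m) - 1\<bar> * 1 \<le> \<bar>cmod (a t m) - 1\<bar> * \<bar>cmod (a t m) + 1\<bar>"
    by (intro mult_left_mono) auto
  also have "\<dots> = \<bar>?c - 1\<bar>" by (simp only: abs_mult[symmetric]) (simp add: power2_eq_square algebra_simps)
  finally show "\<bar>cmod (a t m) - 1\<bar> \<le> (36 + (real m)\<^sup>2) * \<delta>" using c by simp
qed

end

section \<open>Solutions in Sobolev spaces as flows of modes\<close>

abbreviation weighted_sq :: "real \<Rightarrow> (int \<Rightarrow> complex) \<Rightarrow> int \<Rightarrow> real" where
  "weighted_sq s c k \<equiv> (1 + (real_of_int k)\<^sup>2) powr s * (cmod (c k))\<^sup>2"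

lemma sobolev_seq_cmult:
  assumes "c \<in> sobolev_seq s"
  shows "(\<lambda>k. z * c k) \<in> sobolev_seq s"
proof -
  have "(\<lambda>k. (cmod z)\<^sup>2 * weighted_sq s c k) summable_on UNIV"
    using assms unfolding sobolev_seq_def by (intro summable_on_cmult_right) simp
  then show ?thesis by (simp add: sobolev_seq_def norm_mult power_mult_distrib mult.left_commute)
qed

lemma sobolev_seq_diff:
  assumes "b \<in> sobolev_seq s" "c \<in> sobolev_seq s"
  shows "(\<lambda>k. b k - c k) \<in> sobolev_seq s"
proof -
  have "(\<lambda>k. 2 * (weighted_sq s b k + weighted_sq s c k)) summable_on UNIV"
    using assms unfolding sobolev_seq_def by (intro summable_on_cmult_right summable_on_add) auto
  then have "(\<lambda>k. weighted_sq s (\<lambda>k. b k - c k) k) summable_on UNIV"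
  proof (rule summable_on_comparison_test)
    fix k
    have "(cmod (b k - c k))\<^sup>2 \<le> (cmod (b k) + cmod (c k))\<^sup>2"
      by (intro power_mono norm_triangle_ineq4) simp
    also have "\<dots> \<le> 2 * ((cmod (b k))\<^sup>2 + (cmod (c k))\<^sup>2)"
      using zero_le_power2[of "cmod (b k) - cmod (c k)"] by (simp add: power2_eq_square algebra_simps)
    finally have "weighted_sq s (\<lambda>k. b k - c k) k
        \<le> (1 + (real_of_int k)\<^sup>2) powr s * (2 * ((cmod (b k))\<^sup>2 + (cmod (c k))\<^sup>2))"
      by (intro mult_left_mono) auto
    then show "weighted_sq s (\<lambda>k. b k - c k) k \<le> 2 * (weighted_sq s b k + weighted_sq s c k)"
      by (simp add: algebra_simps)
  qed simp
  then show ?thesis by (simp add: sobolev_seq_def)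
qed

lemma finite_sum_le_sobolev_seq_norm:
  assumes "c \<in> sobolev_seq s" "finite F"
  shows "(\<Sum>k\<in>F. weighted_sq s c k) \<le> (sobolev_seq_norm s c)\<^sup>2"
proof -
  have "(\<Sum>k\<in>F. weighted_sq s c k) \<le> infsum (weighted_sq s c) UNIV"
    using assms unfolding sobolev_seq_def by (intro finite_sum_le_infsum) auto
  moreover have "0 \<le> infsum (weighted_sq s c) UNIV" by (intro infsum_nonneg) simp
  ultimately show ?thesis by (simp add: sobolev_seq_norm_def)
qed

lemma sum_nonneg_modes_le_sobolev_norm:
  assumes "c \<in> sobolev_seq 1"
  shows "(\<Sum>k\<le>N. (1 + (real k)\<^sup>2) * (cmod (c (int k)))\<^sup>2) \<le> (sobolev_seq_norm 1 c)\<^sup>2"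
proof -
  have "(\<Sum>k\<le>N. (1 + (real k)\<^sup>2) * (cmod (c (int k)))\<^sup>2) = (\<Sum>k\<in>int ` {..N}. weighted_sq 1 c k)"
    by (simp add: sum.reindex powr_one add_nonneg_nonneg)
  also have "\<dots> \<le> (sobolev_seq_norm 1 c)\<^sup>2" by (intro finite_sum_le_sobolev_seq_norm assms) simp
  finally show ?thesis .
qed

lemma sobolev_norm_le_nonneg_modes:
  assumes c: "\<And>k. k < 0 \<Longrightarrow> c k = 0"
    and B: "\<And>N. (\<Sum>k\<le>N. (1 + (real k)\<^sup>2) * (cmod (c (int k)))\<^sup>2) \<le> B\<^sup>2" and "0 \<le> B"
  shows "sobolev_seq_norm 1 c \<le> B"
proof -
  have "infsum (weighted_sq 1 c) UNIV \<le> B\<^sup>2"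
  proof (cases "weighted_sq 1 c summable_on UNIV")
    case True
    then show ?thesis
    proof (rule infsum_le_finite_sums)
      fix F :: "int set" assume "finite F"
      define N where "N = nat (Max (insert 0 F))"
      have F: "k \<le> int N" if "k \<in> F" for k
        using Max_ge[of "insert 0 F" k] \<open>finite F\<close> that by (simp add: N_def)
      have "sum (weighted_sq 1 c) F = sum (weighted_sq 1 c) (F \<inter> {0..})"
      proof (rule sum.mono_neutral_right[OF \<open>finite F\<close>])
        show "\<forall>k\<in>F - F \<inter> {0..}. weighted_sq 1 c k = 0"
          by (intro ballI) (simp add: c not_le)
      qed auto
      also have "\<dots> \<le> sum (weighted_sq 1 c) (int ` {..N})"
      proof (rule sum_mono2)
        show "F \<inter> {0..} \<subseteq> int ` {..N}"
        proof
          fix k assume "k \<in> F \<inter> {0..}"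
          then show "k \<in> int ` {..N}" using F[of k] by (intro image_eqI[of _ _ "nat k"]) auto
        qed
      qed auto
      also have "\<dots> = (\<Sum>k\<le>N. (1 + (real k)\<^sup>2) * (cmod (c (int k)))\<^sup>2)"
        by (simp add: sum.reindex powr_one add_nonneg_nonneg)
      also note B
      finally show "sum (weighted_sq 1 c) F \<le> B\<^sup>2" .
    qed
  next
    case False
    then show ?thesis by (simp add: infsum_not_exists)
  qed
  then have "sqrt (infsum (weighted_sq 1 c) UNIV) \<le> sqrt (B\<^sup>2)" by (rule real_sqrt_le_mono)
  then show ?thesis using \<open>0 \<le> B\<close> by (simp add: sobolev_seq_norm_def)
qed

lemma sobolev_plus_D:
  assumes "v \<in> sobolev_plus s"
  shows "integrable circle v" "fourier_coeff v \<in> sobolev_seq s" "\<And>k. k < 0 \<Longrightarrow> fourier_coeff v k = 0"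
  using assms L2_circle_integrable by (auto simp: sobolev_plus_def L2_plus_def szego_def)

text \<open>A single coefficient is controlled by the Sobolev norm of any order, so convergence of the difference
  quotients in a weak norm is enough. Membership of the quotients in the space matters, since otherwise the
  norm would be the default value zero.\<close>

lemma has_sobolev_derivative_mode:
  assumes "has_sobolev_derivative s c c' t"
  shows "((\<lambda>\<tau>. c \<tau> k) has_vector_derivative c' k) (at t)"
proof -
  define q where "q h k = (c (t + h) k - c t k) / of_real h - c' k" for h k
  define w where "w = (1 + (real_of_int k)\<^sup>2) powr s"
  have "0 < 1 + (real_of_int k)\<^sup>2" by (simp add: add_pos_nonneg)
  then have w: "0 < w" by (simp add: w_def)
  have c: "\<And>\<tau>. c \<tau> \<in> sobolev_seq s" and c': "c' \<in> sobolev_seq s"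
    and lim: "((\<lambda>h. sobolev_seq_norm s (q h)) \<longlongrightarrow> 0) (at 0)"
    using assms by (auto simp: has_sobolev_derivative_def q_def [abs_def])
  have "q h \<in> sobolev_seq s" for h
  proof -
    have "(\<lambda>k. inverse (of_real h) * (c (t + h) k - c t k) - c' k) \<in> sobolev_seq s"
      by (intro sobolev_seq_diff sobolev_seq_cmult c c')
    then show ?thesis by (simp add: q_def [abs_def] divide_inverse mult.commute)
  qed
  then have "w * (cmod (q h k))\<^sup>2 \<le> (sobolev_seq_norm s (q h))\<^sup>2" for h
    using finite_sum_le_sobolev_seq_norm[of "q h" s "{k}"] by (simp add: w_def)
  then have bound: "norm ((cmod (q h k))\<^sup>2) \<le> (sobolev_seq_norm s (q h))\<^sup>2 / w" for h
    using w by (simp add: pos_le_divide_eq mult.commute)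
  have "((\<lambda>h. (sobolev_seq_norm s (q h))\<^sup>2 / w) \<longlongrightarrow> 0\<^sup>2 / w) (at 0)"
    using w by (intro tendsto_intros lim) simp
  then have "((\<lambda>h. (sobolev_seq_norm s (q h))\<^sup>2 / w) \<longlongrightarrow> 0) (at 0)" by simp
  then have "((\<lambda>h. (cmod (q h k))\<^sup>2) \<longlongrightarrow> 0) (at 0)"
    by (rule Lim_null_comparison[OF always_eventually[OF allI[OF bound]]])
  from tendsto_real_sqrt[OF this] have "((\<lambda>h. cmod (q h k)) \<longlongrightarrow> 0) (at 0)" by simp
  then have qz: "((\<lambda>h. q h k) \<longlongrightarrow> 0) (at 0)" by (rule tendsto_norm_zero_cancel)
  have "((\<lambda>h. q h k + c' k) \<longlongrightarrow> 0 + c' k) (at 0)" by (intro tendsto_intros qz)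
  then have quot: "((\<lambda>h. (c (t + h) k - c t k) / of_real h) \<longlongrightarrow> c' k) (at 0)" by (simp add: q_def)
  show ?thesis
    unfolding has_vector_derivative_complex_iff DERIV_def
    using tendsto_Re[OF quot] tendsto_Im[OF quot] by simp
qed

text \<open>Continuity in \<open>H\<^sup>1\<close> bounds the norm near every time, and bisection of the interval makes the bound
  uniform.\<close>

lemma solution_locally_bounded:
  fixes u :: "real \<Rightarrow> real \<Rightarrow> complex"
  assumes u: "\<And>t. u t \<in> sobolev_plus 1"
    and cont: "\<And>t. ((\<lambda>\<tau>. sobolev_norm 1 (\<lambda>x. u \<tau> x - u t x)) \<longlongrightarrow> 0) (at t)"
  shows "\<exists>R. \<forall>t\<in>{S..T::real}. \<forall>N. (\<Sum>k\<le>N. (1 + real k)\<^sup>2 * (cmod (fourier_coeff (u t) (int k)))\<^sup>2) \<le> R"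
proof (cases "S \<le> T")
  case True
  then show ?thesis
  proof (induction S T rule: Bolzano)
    case (trans a b c)
    then obtain R R' where
      R: "\<forall>t\<in>{a..b}. \<forall>N. (\<Sum>k\<le>N. (1 + real k)\<^sup>2 * (cmod (fourier_coeff (u t) (int k)))\<^sup>2) \<le> R"
      and R': "\<forall>t\<in>{b..c}. \<forall>N. (\<Sum>k\<le>N. (1 + real k)\<^sup>2 * (cmod (fourier_coeff (u t) (int k)))\<^sup>2) \<le> R'" by blast
    have "\<forall>t\<in>{a..c}. \<forall>N. (\<Sum>k\<le>N. (1 + real k)\<^sup>2 * (cmod (fourier_coeff (u t) (int k)))\<^sup>2) \<le> max R R'"
    proof (intro ballI allI)
      fix t N assume t: "t \<in> {a..c}"
      show "(\<Sum>k\<le>N. (1 + real k)\<^sup>2 * (cmod (fourier_coeff (u t) (int k)))\<^sup>2) \<le> max R R'"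
      proof (cases "t \<le> b")
        case True
        with t R show ?thesis by (intro max.coboundedI1) auto
      next
        case False
        with t R' show ?thesis by (intro max.coboundedI2) auto
      qed
    qed
    then show ?case by blast
  next
    case (local x)
    let ?n = "\<lambda>v. sobolev_seq_norm 1 (fourier_coeff v)"
    have "\<forall>\<^sub>F \<tau> in at x. sobolev_norm 1 (\<lambda>y. u \<tau> y - u x y) < 1"
      by (rule order_tendstoD(2)[OF cont]) simp
    then obtain d where d: "0 < d" "\<And>\<tau>. \<tau> \<noteq> x \<Longrightarrow> dist \<tau> x < d \<Longrightarrow> sobolev_norm 1 (\<lambda>y. u \<tau> y - u x y) < 1"
      by (auto simp: eventually_at)
    \<comment> \<open>The factor 4 is \<open>2 * 2\<close>: \<open>(x + y)\<^sup>2 \<le> 2 (x\<^sup>2 + y\<^sup>2)\<close> is applied to the weight and to the coefficient.\<close>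
    let ?R = "4 * (1 + (?n (u x))\<^sup>2)"
    have near: "(\<Sum>k\<le>N. (1 + real k)\<^sup>2 * (cmod (fourier_coeff (u \<tau>) (int k)))\<^sup>2) \<le> ?R"
      if "dist \<tau> x < d" for \<tau> N
    proof -
      let ?e = "\<lambda>k. fourier_coeff (u \<tau>) k - fourier_coeff (u x) k"
      have e: "fourier_coeff (\<lambda>y. u \<tau> y - u x y) = ?e"
        using sobolev_plus_D(1)[OF u] by (simp add: fun_eq_iff fourier_coeff_diff)
      have "sobolev_seq_norm 1 ?e \<le> 1"
      proof (cases "\<tau> = x")
        case True
        then show ?thesis by (simp add: sobolev_seq_norm_def)
      next
        case False
        then show ?thesis using d(2)[OF False that] by (simp add: sobolev_norm_def e)
      qed
      moreover have "0 \<le> sobolev_seq_norm 1 ?e" by (simp add: sobolev_seq_norm_def infsum_nonneg)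
      ultimately have e1: "(sobolev_seq_norm 1 ?e)\<^sup>2 \<le> 1" by (simp add: power_le_one)
      have "(\<Sum>k\<le>N. (1 + real k)\<^sup>2 * (cmod (fourier_coeff (u \<tau>) (int k)))\<^sup>2)
          \<le> (\<Sum>k\<le>N. 4 * ((1 + (real k)\<^sup>2) * (cmod (?e (int k)))\<^sup>2) +
                4 * ((1 + (real k)\<^sup>2) * (cmod (fourier_coeff (u x) (int k)))\<^sup>2))"
      proof (rule sum_mono)
        fix k
        let ?p = "cmod (?e (int k))" and ?q = "cmod (fourier_coeff (u x) (int k))"
        have "(1 + real k)\<^sup>2 \<le> 2 * (1 + (real k)\<^sup>2)"
          using zero_le_power2[of "real k - 1"] by (simp add: power2_eq_square algebra_simps)
        moreover have "(cmod (fourier_coeff (u \<tau>) (int k)))\<^sup>2 \<le> 2 * (?p\<^sup>2 + ?q\<^sup>2)"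
        proof -
          have "cmod (fourier_coeff (u \<tau>) (int k)) \<le> ?p + ?q"
            using norm_triangle_ineq[of "?e (int k)" "fourier_coeff (u x) (int k)"] by simp
          then have "(cmod (fourier_coeff (u \<tau>) (int k)))\<^sup>2 \<le> (?p + ?q)\<^sup>2" by (intro power_mono) auto
          also have "\<dots> \<le> 2 * (?p\<^sup>2 + ?q\<^sup>2)"
            using zero_le_power2[of "?p - ?q"] by (simp add: power2_eq_square algebra_simps)
          finally show ?thesis .
        qed
        ultimately have "(1 + real k)\<^sup>2 * (cmod (fourier_coeff (u \<tau>) (int k)))\<^sup>2
            \<le> (2 * (1 + (real k)\<^sup>2)) * (2 * (?p\<^sup>2 + ?q\<^sup>2))"
          by (intro mult_mono) auto
        also have "\<dots> = 4 * ((1 + (real k)\<^sup>2) * ?p\<^sup>2) + 4 * ((1 + (real k)\<^sup>2) * ?q\<^sup>2)"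
          by (simp add: algebra_simps)
        finally show "(1 + real k)\<^sup>2 * (cmod (fourier_coeff (u \<tau>) (int k)))\<^sup>2
            \<le> 4 * ((1 + (real k)\<^sup>2) * ?p\<^sup>2) + 4 * ((1 + (real k)\<^sup>2) * ?q\<^sup>2)" .
      qed
      also have "\<dots> = 4 * (\<Sum>k\<le>N. (1 + (real k)\<^sup>2) * (cmod (?e (int k)))\<^sup>2)
          + 4 * (\<Sum>k\<le>N. (1 + (real k)\<^sup>2) * (cmod (fourier_coeff (u x) (int k)))\<^sup>2)"
        by (simp only: sum.distrib sum_distrib_left)
      also have "\<dots> \<le> 4 * (sobolev_seq_norm 1 ?e)\<^sup>2 + 4 * (?n (u x))\<^sup>2"
        using sobolev_plus_D(2)[OF u]
        by (intro add_mono mult_left_mono sum_nonneg_modes_le_sobolev_norm sobolev_seq_diff) auto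
      finally show ?thesis using e1 by simp
    qed
    show ?case
    proof (intro exI conjI allI impI)
      fix a b assume "a \<le> x \<and> x \<le> b \<and> b - a < d"
      then have "dist t x < d" if "t \<in> {a..b}" for t using that by (auto simp: dist_real_def)
      then show "\<forall>t\<in>{a..b}. \<forall>N. (\<Sum>k\<le>N. (1 + real k)\<^sup>2 * (cmod (fourier_coeff (u t) (int k)))\<^sup>2) \<le> ?R"
        using near by blast
    qed (rule d(1))
  qed
qed auto

lemma solution_mode_flow:
  assumes sol: "nls_szego_solution 1 \<epsilon> \<alpha> u" and "0 < \<epsilon>" "\<epsilon> \<le> 1" "0 \<le> \<alpha>"
  shows "mode_flow (\<lambda>t k. fourier_coeff (u t) (int k))
    (\<lambda>t k. fourier_coeff (\<lambda>x. of_real ((cmod (u t x))\<^sup>2) * u t x) (int k)) (\<epsilon> powr \<alpha>)"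
proof -
  have u: "u t \<in> sobolev_plus 1" for t using sol by (simp add: nls_szego_solution_def)
  have cont: "((\<lambda>\<tau>. sobolev_norm 1 (\<lambda>x. u \<tau> x - u t x)) \<longlongrightarrow> 0) (at t)" for t
    using sol by (simp add: nls_szego_solution_def)
  note bounded = solution_locally_bounded[OF u cont]
  obtain ut where ut: "\<And>t. has_sobolev_derivative (1 - 2) (\<lambda>\<tau>. fourier_coeff (u \<tau>)) (ut t) t"
    and eq: "\<And>t k. \<i> * ut t k + of_real (\<epsilon> powr \<alpha>) * deriv_x (deriv_x (fourier_coeff (u t))) k =
             szego (fourier_coeff (\<lambda>x. of_real ((cmod (u t x))\<^sup>2) * u t x)) k"
    using sol unfolding nls_szego_solution_def by blast
  show ?thesis
  proof
    fix t :: real and k :: nat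
    let ?c = "fourier_coeff (u t) (int k)"
    let ?f = "fourier_coeff (\<lambda>x. of_real ((cmod (u t x))\<^sup>2) * u t x) (int k)"
    have "ut t (int k) = - \<i> * (\<i> * ut t (int k))" by simp
    also have "\<i> * ut t (int k) = of_real (\<epsilon> powr \<alpha> * (real k)\<^sup>2) * ?c + ?f"
      using eq[of t "int k"] by (simp add: deriv_x_def szego_def power2_eq_square algebra_simps)
    finally have "ut t (int k) = - \<i> * (of_real (\<epsilon> powr \<alpha> * (real k)\<^sup>2) * ?c + ?f)" .
    then show "((\<lambda>t. fourier_coeff (u t) (int k)) has_vector_derivative
        - \<i> * (of_real (\<epsilon> powr \<alpha> * (real k)\<^sup>2) * ?c + ?f)) (at t)"
      using has_sobolev_derivative_mode[OF ut, of "int k" t] by simp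
    obtain R where "\<And>N. (\<Sum>k\<le>N. (1 + real k)\<^sup>2 * (cmod (fourier_coeff (u t) (int k)))\<^sup>2) \<le> R"
      using bounded[of t t] by auto
    from sum_norm_le_weighted[OF this]
    show "(\<lambda>M. cubic (\<lambda>k. fourier_coeff (u t) (int k)) M k) \<longlonglongrightarrow> ?f"
      by (intro cubic_tendsto_fourier_coeff[of "u t"] sobolev_plus_D[OF u]) auto
  next
    fix S T :: real
    show "\<exists>R. \<forall>t\<in>{S..T}. \<forall>N. (\<Sum>k\<le>N. (1 + real k)\<^sup>2 * (cmod (fourier_coeff (u t) (int k)))\<^sup>2) \<le> R"
      by (rule bounded)
  next
    show "0 \<le> \<epsilon> powr \<alpha>" by simp
    show "\<epsilon> powr \<alpha> \<le> 1" using assms by (simp add: powr_le1)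
  qed
qed

section \<open>Orbital stability\<close>

text \<open>The phase is chosen as the argument of the mode \<open>m\<close>; then the distance in this mode is the
  defect of its modulus. For \<open>k \<noteq> m\<close> the \<open>H\<^sup>1\<close> weight is comparable to \<open>(k - m)\<^sup>2\<close>, because \<open>(k - m)\<^sup>2 \<ge> 1\<close>.\<close>

lemma orbital_distance_le:
  fixes b :: "nat \<Rightarrow> complex"
  assumes G: "\<And>N. (\<Sum>k\<le>N. (real k - real m)\<^sup>2 * (cmod (b k))\<^sup>2) \<le> K * \<delta>\<^sup>2"
    and D: "\<bar>cmod (b m) - 1\<bar> \<le> L * \<delta>" and "0 \<le> K" "0 \<le> \<delta>"
  shows "\<exists>\<theta>. \<forall>N. (\<Sum>k\<le>N. (1 + (real k)\<^sup>2) * (cmod (b k - (if k = m then exp (\<i> * of_real \<theta>) else 0)))\<^sup>2)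
    \<le> ((3 + 2 * (real m)\<^sup>2) * K + (1 + (real m)\<^sup>2) * L\<^sup>2) * \<delta>\<^sup>2"
proof (intro exI allI)
  fix N
  define \<theta> where "\<theta> = Arg (b m)"
  let ?z = "exp (\<i> * of_real \<theta>)"
  have "b m = of_real (cmod (b m)) * ?z"
    using rcis_cmod_Arg[of "b m"] by (simp add: rcis_def cis_conv_exp \<theta>_def)
  then have "b m - ?z = of_real (cmod (b m) - 1) * ?z" by (simp add: left_diff_distrib)
  then have "cmod (b m - ?z) = \<bar>cmod (b m) - 1\<bar>"
    by (simp only: norm_mult norm_of_real norm_exp_i_times mult_1_right)
  with D have zm: "(cmod (b m - ?z))\<^sup>2 \<le> L\<^sup>2 * \<delta>\<^sup>2"
    using power_mono[of "cmod (b m - ?z)" "L * \<delta>" 2] by (simp add: power_mult_distrib)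
  have "(\<Sum>k\<le>N. (1 + (real k)\<^sup>2) * (cmod (b k - (if k = m then ?z else 0)))\<^sup>2)
      \<le> (\<Sum>k\<le>N. (3 + 2 * (real m)\<^sup>2) * ((real k - real m)\<^sup>2 * (cmod (b k))\<^sup>2)
          + (if k = m then (1 + (real m)\<^sup>2) * (cmod (b m - ?z))\<^sup>2 else 0))"
  proof (rule sum_mono)
    fix k
    have "1 + (real k)\<^sup>2 \<le> (3 + 2 * (real m)\<^sup>2) * (real k - real m)\<^sup>2" if "k \<noteq> m"
    proof -
      have "1 \<le> \<bar>real k - real m\<bar>" using that by linarith
      from power_mono[OF this, of 2] have "1 \<le> (real k - real m)\<^sup>2" by simp
      from mult_left_mono[OF this, of "1 + 2 * (real m)\<^sup>2"]
      have "1 + 2 * (real m)\<^sup>2 \<le> (1 + 2 * (real m)\<^sup>2) * (real k - real m)\<^sup>2" by simp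
      moreover have "(real k)\<^sup>2 \<le> 2 * (real k - real m)\<^sup>2 + 2 * (real m)\<^sup>2"
        using zero_le_power2[of "real k - 2 * real m"] by (simp add: power2_eq_square algebra_simps)
      ultimately show ?thesis by (simp add: distrib_right)
    qed
    from mult_right_mono[OF this, of "(cmod (b k))\<^sup>2"]
    show "(1 + (real k)\<^sup>2) * (cmod (b k - (if k = m then ?z else 0)))\<^sup>2
      \<le> (3 + 2 * (real m)\<^sup>2) * ((real k - real m)\<^sup>2 * (cmod (b k))\<^sup>2)
          + (if k = m then (1 + (real m)\<^sup>2) * (cmod (b m - ?z))\<^sup>2 else 0)"
      by (cases "k = m") (simp_all add: mult.assoc)
  qed
  also have "\<dots> = (3 + 2 * (real m)\<^sup>2) * (\<Sum>k\<le>N. (real k - real m)\<^sup>2 * (cmod (b k))\<^sup>2)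
      + (if m \<le> N then (1 + (real m)\<^sup>2) * (cmod (b m - ?z))\<^sup>2 else 0)"
    by (simp add: sum.distrib flip: sum_distrib_left)
  also have "\<dots> \<le> (3 + 2 * (real m)\<^sup>2) * (K * \<delta>\<^sup>2) + (1 + (real m)\<^sup>2) * (L\<^sup>2 * \<delta>\<^sup>2)"
    using mult_left_mono[OF zm, of "1 + (real m)\<^sup>2"]
    by (intro add_mono mult_left_mono G) (auto intro: order_trans)
  finally show "(\<Sum>k\<le>N. (1 + (real k)\<^sup>2) * (cmod (b k - (if k = m then exp (\<i> * of_real \<theta>) else 0)))\<^sup>2)
    \<le> ((3 + 2 * (real m)\<^sup>2) * K + (1 + (real m)\<^sup>2) * L\<^sup>2) * \<delta>\<^sup>2"
    by (simp add: algebra_simps)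
qed

text \<open>The constant of \<open>orbital_distance_le\<close> for the values \<open>K = 33 + m\<^sup>2\<close> and \<open>L = 36 + m\<^sup>2\<close> from
  \<open>orbital_bounds\<close>.\<close>

definition stability_const :: "nat \<Rightarrow> real" where
  "stability_const m = sqrt ((3 + 2 * (real m)\<^sup>2) * (33 + (real m)\<^sup>2) + (1 + (real m)\<^sup>2) * (36 + (real m)\<^sup>2)\<^sup>2)"

lemma stability_const_pos: "0 < stability_const m"
  unfolding stability_const_def
  by (rule real_sqrt_gt_zero, rule add_pos_nonneg[OF mult_pos_pos]) (simp_all add: add_pos_nonneg)

lemma orbital_stability:
  assumes sol: "nls_szego_solution 1 \<epsilon> \<alpha> u" and eps: "0 < \<epsilon>" "\<epsilon> < 1" and alpha: "0 \<le> \<alpha>" "\<alpha> \<le> 2"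
    and init: "sobolev_norm 1 (\<lambda>x. u 0 x - fourier_mode m x) = \<epsilon>"
  shows "\<exists>\<theta>. sobolev_norm 1 (\<lambda>x. u t x - exp (\<i> * of_real \<theta>) * fourier_mode m x)
    \<le> stability_const m * \<epsilon> powr (1 - \<alpha> / 2)"
proof -
  define a where "a t k = fourier_coeff (u t) (int k)" for t k
  define \<delta> where "\<delta> = \<epsilon> powr (1 - \<alpha> / 2)"
  interpret mode_flow a "\<lambda>t k. fourier_coeff (\<lambda>x. of_real ((cmod (u t x))\<^sup>2) * u t x) (int k)" "\<epsilon> powr \<alpha>"
    unfolding a_def using solution_mode_flow[OF sol] eps alpha by simp
  have u: "u t \<in> sobolev_plus 1" for t using sol by (simp add: nls_szego_solution_def)
  have coeff: "fourier_coeff (\<lambda>x. u t x - z * fourier_mode m x)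
      = (\<lambda>k. fourier_coeff (u t) k - (if k = int m then z else 0))" for t z
    using sobolev_plus_D(1)[OF u]
    by (simp add: fun_eq_iff fourier_mode_eq_wave fourier_coeff_diff fourier_coeff_wave)
  \<comment> \<open>The three relations say that \<open>\<delta>\<^sup>2\<close> is \<open>\<epsilon>\<^sup>2 / \<epsilon>\<^sup>\<alpha>\<close> and lies between \<open>\<epsilon>\<^sup>2\<close> and 1; the upper bound is where \<open>\<alpha> \<le> 2\<close> enters.\<close>
  have "\<epsilon> powr 1 \<le> \<epsilon> powr (1 - \<alpha> / 2)" using eps alpha by (intro powr_mono') auto
  then have d1: "\<epsilon> \<le> \<delta>" using eps by (simp add: \<delta>_def)
  have d2: "\<delta> \<le> 1" using eps alpha by (simp add: \<delta>_def powr_le1)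
  have d3: "\<epsilon> powr \<alpha> * \<delta>\<^sup>2 = \<epsilon>\<^sup>2"
  proof -
    have "\<epsilon> powr \<alpha> * \<delta>\<^sup>2 = \<epsilon> powr (\<alpha> + ((1 - \<alpha> / 2) + (1 - \<alpha> / 2)))"
      by (simp only: \<delta>_def power2_eq_square powr_add)
    also have "\<alpha> + ((1 - \<alpha> / 2) + (1 - \<alpha> / 2)) = 2" by simp
    finally show ?thesis using eps by simp
  qed
  have init': "(\<Sum>k\<le>N. (1 + (real k)\<^sup>2) * (cmod (a 0 k - (if k = m then 1 else 0)))\<^sup>2) \<le> \<epsilon>\<^sup>2" for N
  proof -
    let ?d = "\<lambda>k. fourier_coeff (u 0) k - (if k = int m then 1 else 0)"
    have "(\<lambda>k. if k = int m then 1 else 0) \<in> sobolev_seq 1"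
    proof -
      have "(\<lambda>k. weighted_sq 1 (\<lambda>k. if k = int m then 1 else 0) k) summable_on {int m}" by simp
      then have "(\<lambda>k. weighted_sq 1 (\<lambda>k. if k = int m then 1 else 0) k) summable_on UNIV"
        by (rule summable_on_cong_neutral[THEN iffD1, rotated -1]) auto
      then show ?thesis by (simp add: sobolev_seq_def)
    qed
    then have "?d \<in> sobolev_seq 1" by (intro sobolev_seq_diff sobolev_plus_D(2)[OF u])
    from sum_nonneg_modes_le_sobolev_norm[OF this, of N]
    show ?thesis using init coeff[of 0 1] by (simp add: sobolev_norm_def a_def)
  qed
  obtain \<theta> where \<theta>: "\<And>N. (\<Sum>k\<le>N. (1 + (real k)\<^sup>2) * (cmod (a t k - (if k = m then exp (\<i> * of_real \<theta>) else 0)))\<^sup>2)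
    \<le> ((3 + 2 * (real m)\<^sup>2) * (33 + (real m)\<^sup>2) + (1 + (real m)\<^sup>2) * (36 + (real m)\<^sup>2)\<^sup>2) * \<delta>\<^sup>2"
    using orbital_distance_le[OF orbital_bounds[OF eps d1 d2 d3 init']] eps d1 by auto
  have "sobolev_seq_norm 1 (fourier_coeff (\<lambda>x. u t x - exp (\<i> * of_real \<theta>) * fourier_mode m x)) \<le> stability_const m * \<delta>"
    unfolding coeff
  proof (rule sobolev_norm_le_nonneg_modes)
    show "fourier_coeff (u t) k - (if k = int m then exp (\<i> * of_real \<theta>) else 0) = 0" if "k < 0" for k
      using sobolev_plus_D(3)[OF u that] that by simp
    show "0 \<le> stability_const m * \<delta>" using stability_const_pos[of m] by (simp add: \<delta>_def)
    have "(stability_const m * \<delta>)\<^sup>2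
        = ((3 + 2 * (real m)\<^sup>2) * (33 + (real m)\<^sup>2) + (1 + (real m)\<^sup>2) * (36 + (real m)\<^sup>2)\<^sup>2) * \<delta>\<^sup>2"
      unfolding stability_const_def power_mult_distrib by (subst real_sqrt_pow2) auto
    then show "(\<Sum>k\<le>N. (1 + (real k)\<^sup>2) * (cmod (fourier_coeff (u t) (int k) - (if int k = int m then exp (\<i> * of_real \<theta>) else 0)))\<^sup>2)
        \<le> (stability_const m * \<delta>)\<^sup>2" for N
      using \<theta>[of N] by (simp add: a_def)
  qed
  then show ?thesis unfolding sobolev_norm_def \<delta>_def by blast
qed

theorem theorem1p5:
  "\<forall>m::nat. \<exists>C::real. C > 0 \<and>
     (\<forall>\<epsilon>\<in>{0<..<1::real}. \<forall>\<alpha>\<in>{0..2::real}. \<forall>u :: real \<Rightarrow> real \<Rightarrow> complex.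
        nls_szego_solution 1 \<epsilon> \<alpha> u \<longrightarrow>
        sobolev_norm 1 (\<lambda>x. u 0 x - fourier_mode m x) = \<epsilon> \<longrightarrow>
        (SUP t::real. INF \<theta>::real. ereal (sobolev_norm 1 (\<lambda>x. u t x - exp (\<i> * of_real \<theta>) * fourier_mode m x)))
          \<le> ereal (C * \<epsilon> powr (1 - \<alpha> / 2)))"
proof (intro allI exI conjI ballI impI)
  fix m :: nat
  show "0 < stability_const m" by (rule stability_const_pos)
  fix \<epsilon> \<alpha> :: real and u :: "real \<Rightarrow> real \<Rightarrow> complex"
  assume a: "\<epsilon> \<in> {0<..<1}" "\<alpha> \<in> {0..2}" "nls_szego_solution 1 \<epsilon> \<alpha> u"
    "sobolev_norm 1 (\<lambda>x. u 0 x - fourier_mode m x) = \<epsilon>"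
  show "(SUP t::real. INF \<theta>::real. ereal (sobolev_norm 1 (\<lambda>x. u t x - exp (\<i> * of_real \<theta>) * fourier_mode m x)))
      \<le> ereal (stability_const m * \<epsilon> powr (1 - \<alpha> / 2))"
  proof (rule SUP_least)
    fix t :: real
    obtain \<theta> where "sobolev_norm 1 (\<lambda>x. u t x - exp (\<i> * of_real \<theta>) * fourier_mode m x)
        \<le> stability_const m * \<epsilon> powr (1 - \<alpha> / 2)"
      using orbital_stability[OF a(3) _ _ _ _ a(4)] a(1,2) by auto
    then show "(INF \<theta>::real. ereal (sobolev_norm 1 (\<lambda>x. u t x - exp (\<i> * of_real \<theta>) * fourier_mode m x)))
        \<le> ereal (stability_const m * \<epsilon> powr (1 - \<alpha> / 2))"
      by (intro INF_lower2[of \<theta>]) auto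
  qed
qed

end
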